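(* If $R$ is a polynomial ring in finitely many variables over a field and $I\subseteq R$ is a monomial ideal, then $C(I)$ is a monomial ideal; and if $R$ is a Noetherian graded ring and $I$ is a graded ideal in $R$, then $C(I)$ is a graded ideal.
   Context: All rings are commutative with unit; graded means $\mathbb{Z}$-graded. For a Noetherian ring $R$ and an ideal $I=(f_1,\ldots,f_m)\subseteq R$, let $\mathcal{R}(I)=R[f_1t,\ldots,f_mt]\subseteq R[t]$ be the Rees algebra, $T=R[y_1,\ldots,y_m]$ a polynomial ring, $\varphi:T\to\mathcal{R}(I)$ the $R$-algebra homomorphism with $\varphi(y_j)=f_jt$, and $J=\ker\varphi$. Let $L\subseteq J$ be the ideal of $T$ generated by all linear relations $\sum_{i=1}^m a_iy_i$ with $a_i\in R$ and $\sum_i a_if_i=0$. Then $T/L\cong S(I)$ is the symmetric algebra of $I$, and the kernel of the canonical epimorphism $\alpha:S(I)\to\mathcal{R}(I)$ is $J/L$. The conductor of $I$ is the ideal $C(I)=L:_RJ=\{r\in R: rJ\subseteq L\}=\mathrm{Ann}_R(\ker\alpha)$ of $R$; it does not depend on the chosen generators. *)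

theory Defs
  imports "HOL-Algebra.Algebra"
begin

text \<open>
  The polynomial ring over \<open>R\<close> in the variables from the set \<open>V\<close>, built on the indexed
  polynomials of \<^theory>\<open>HOL-Algebra.Indexed_Polynomials\<close>: a monomial is a multiset of
  variables and a polynomial maps each monomial to its coefficient. That theory has no product
  of two indexed polynomials; it is convolution over the (finitely many) factorisations of a
  monomial.
\<close>

definition mpoly_ring :: "('a, 'b) ring_scheme \<Rightarrow> 'v set \<Rightarrow> ('v multiset \<Rightarrow> 'a) ring"
  where "mpoly_ring R V =
    \<lparr> carrier = ring.indexed_pset R V (carrier R),
      monoid.mult = (\<lambda>P Q n. \<Oplus>\<^bsub>R\<^esub>a\<in>{a. a \<subseteq># n}. P a \<otimes>\<^bsub>R\<^esub> Q (n - a)),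
      one = ring.indexed_const R \<one>\<^bsub>R\<^esub>,
      ring.zero = ring.indexed_const R \<zero>\<^bsub>R\<^esub>,
      ring.add = ring.indexed_padd R \<rparr>"

text \<open>The value of a polynomial over \<open>R\<close> in \<open>S\<close>, where \<open>h\<close> maps coefficients
  to \<open>S\<close> and \<open>s j\<close> is substituted for the variable \<open>j\<close>.\<close>

definition mpoly_eval ::
    "('a, 'b) ring_scheme \<Rightarrow> ('c, 'd) ring_scheme \<Rightarrow> ('a \<Rightarrow> 'c) \<Rightarrow> ('v \<Rightarrow> 'c)
      \<Rightarrow> ('v multiset \<Rightarrow> 'a) \<Rightarrow> 'c"
  where "mpoly_eval R S h s P =
    (\<Oplus>\<^bsub>S\<^esub>n\<in>{n. P n \<noteq> \<zero>\<^bsub>R\<^esub>}.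
       h (P n) \<otimes>\<^bsub>S\<^esub> (\<Otimes>\<^bsub>S\<^esub>j\<in>set_mset n. s j [^]\<^bsub>S\<^esub> count n j))"

text \<open>
  In the following, an ideal is given by generators \<open>f 0, \<dots>, f (m - 1)\<close>; the ring
  \<open>T = R[y\<^sub>0, \<dots>, y\<^sub>m\<^sub>-\<^sub>1]\<close> is \<^term>\<open>mpoly_ring R {..<m}\<close>, and
  \<open>R[t]\<close> is \<^term>\<open>UP R\<close>, so that \<open>r t\<^sup>k\<close> is \<^term>\<open>monom (UP R) r k\<close>.
\<close>

definition generated_by ::
    "('a, 'b) ring_scheme \<Rightarrow> 'a set \<Rightarrow> nat \<Rightarrow> (nat \<Rightarrow> 'a) \<Rightarrow> bool"
  where "generated_by R I m f \<longleftrightarrow> f \<in> {..<m} \<rightarrow> carrier R \<and> I = genideal R (f ` {..<m})"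

definition rees_algebra ::
    "('a, 'b) ring_scheme \<Rightarrow> nat \<Rightarrow> (nat \<Rightarrow> 'a) \<Rightarrow> ('a, nat \<Rightarrow> 'a) up_ring"
  where "rees_algebra R m f =
    (UP R)\<lparr> carrier := generate_ring (UP R)
      ((\<lambda>r. monom (UP R) r 0) ` carrier R \<union> (\<lambda>j. monom (UP R) (f j) 1) ` {..<m}) \<rparr>"

definition rees_hom ::
    "('a, 'b) ring_scheme \<Rightarrow> (nat \<Rightarrow> 'a) \<Rightarrow> (nat multiset \<Rightarrow> 'a) \<Rightarrow> (nat \<Rightarrow> 'a)"
  where "rees_hom R f =
    mpoly_eval R (UP R) (\<lambda>r. monom (UP R) r 0) (\<lambda>j. monom (UP R) (f j) 1)"

definition rees_ideal ::
    "('a, 'b) ring_scheme \<Rightarrow> nat \<Rightarrow> (nat \<Rightarrow> 'a) \<Rightarrow> (nat multiset \<Rightarrow> 'a) set"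
  where "rees_ideal R m f = a_kernel (mpoly_ring R {..<m}) (rees_algebra R m f) (rees_hom R f)"

definition linear_relations ::
    "('a, 'b) ring_scheme \<Rightarrow> nat \<Rightarrow> (nat \<Rightarrow> 'a) \<Rightarrow> (nat multiset \<Rightarrow> 'a) set"
  where "linear_relations R m f =
    {(\<Oplus>\<^bsub>mpoly_ring R {..<m}\<^esub>i\<in>{..<m}.
        ring.indexed_const R (a i) \<otimes>\<^bsub>mpoly_ring R {..<m}\<^esub> ring.indexed_var R i)
      | a. a \<in> {..<m} \<rightarrow> carrier R \<and> (\<Oplus>\<^bsub>R\<^esub>i\<in>{..<m}. a i \<otimes>\<^bsub>R\<^esub> f i) = \<zero>\<^bsub>R\<^esub>}"

definition linear_ideal ::
    "('a, 'b) ring_scheme \<Rightarrow> nat \<Rightarrow> (nat \<Rightarrow> 'a) \<Rightarrow> (nat multiset \<Rightarrow> 'a) set"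
  where "linear_ideal R m f = genideal (mpoly_ring R {..<m}) (linear_relations R m f)"

text \<open>The conductor \<open>C(I)\<close>, computed from generators of \<open>I\<close>. It depends only on the
  ideal they generate; statements about \<open>C(I)\<close> are made for every finite system of
  generators of \<open>I\<close>.\<close>

definition conductor :: "('a, 'b) ring_scheme \<Rightarrow> nat \<Rightarrow> (nat \<Rightarrow> 'a) \<Rightarrow> 'a set"
  where "conductor R m f =
    {r \<in> carrier R. \<forall>P\<in>rees_ideal R m f.
       ring.indexed_const R r \<otimes>\<^bsub>mpoly_ring R {..<m}\<^esub> P \<in> linear_ideal R m f}"

definition monomials :: "('a, 'b) ring_scheme \<Rightarrow> 'v set \<Rightarrow> ('v multiset \<Rightarrow> 'a) set"
  where "monomials K V = {(\<lambda>n. if n = a then \<one>\<^bsub>K\<^esub> else \<zero>\<^bsub>K\<^esub>) | a. set_mset a \<subseteq> V}"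

definition monomial_ideal ::
    "('a, 'b) ring_scheme \<Rightarrow> 'v set \<Rightarrow> ('v multiset \<Rightarrow> 'a) set \<Rightarrow> bool"
  where "monomial_ideal K V I \<longleftrightarrow> (\<exists>S \<subseteq> monomials K V. I = genideal (mpoly_ring K V) S)"

text \<open>The last clause says that \<open>R\<close> is the direct sum of its homogeneous components
  \<open>A i\<close>: each element has a unique decomposition \<open>c\<close>.\<close>

definition graded_ring :: "('a, 'b) ring_scheme \<Rightarrow> (int \<Rightarrow> 'a set) \<Rightarrow> bool"
  where "graded_ring R A \<longleftrightarrow>
    cring R \<and>
    (\<forall>i. additive_subgroup (A i) R) \<and>
    (\<forall>i j. \<forall>x\<in>A i. \<forall>y\<in>A j. x \<otimes>\<^bsub>R\<^esub> y \<in> A (i + j)) \<and>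
    (\<forall>x\<in>carrier R. \<exists>!c. (\<forall>i. c i \<in> A i) \<and> finite {i. c i \<noteq> \<zero>\<^bsub>R\<^esub>} \<and>
       x = (\<Oplus>\<^bsub>R\<^esub>i\<in>{i. c i \<noteq> \<zero>\<^bsub>R\<^esub>}. c i))"

definition graded_ideal ::
    "('a, 'b) ring_scheme \<Rightarrow> (int \<Rightarrow> 'a set) \<Rightarrow> 'a set \<Rightarrow> bool"
  where "graded_ideal R A I \<longleftrightarrow> (\<exists>S \<subseteq> (\<Union>i. A i). I = genideal R S)"

end

theory Submission
  imports Defs
begin

text \<open>
  Let \<open>R\<close> be graded and let \<open>I\<close> have homogeneous generators \<open>f i\<close> of degree
  \<open>d i\<close>. Giving \<open>y i\<close> the degree \<open>d i\<close> makes \<open>T\<close> a graded ring in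
  which both \<open>J\<close> and \<open>L\<close> are homogeneous. If \<open>r J \<subseteq> L\<close> and
  \<open>P \<in> J\<close> is homogeneous of degree \<open>e\<close>, then \<open>r\<^sub>k P\<close> is the component of
  \<open>r P \<in> L\<close> of degree \<open>k + e\<close>, so \<open>r\<^sub>k \<in> C(I)\<close>. This uses only cancellation of degrees,
  so it also applies to the grading of \<open>K[V]\<close> by the monoid of monomials, whose homogeneous
  ideals are the monomial ideals. Arbitrary generators are exchanged for their homogeneous
  components, since the conductor depends only on the ideal.
\<close>

section \<open>The ring of indexed polynomials\<close>

text \<open>When the degrees are monomials, a difference \<open>e - d\<close> of degrees need not
  exist. A grading is therefore a family of projections indexed by a cancellative commutative
  monoid, and \<open>shift_comp\<close> totalises the component of degree \<open>e - d\<close> by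
  zero. With it the grading of \<open>R\<close> extends to \<open>T\<close> as an instance of the
  same locale, so that facts such as the stability of homogeneously generated ideals are proved once
  and used for \<open>R\<close> and for \<open>T\<close>. \<open>J\<close> is homogeneous because
  the Rees map preserves degrees once \<open>t\<close> gets degree zero: \<open>y i\<close> and its
  image \<open>f i t\<close> both have degree \<open>d i\<close>. \<open>L\<close> is homogeneous
  because the components of a relation among homogeneous \<open>f i\<close> are again relations. The
  exchange of generators rests on matrices that express each system through the other. They define
  linear substitutions between the two polynomial rings, and the composite moves each variable only
  by a linear relation. In \<open>K[V]\<close> a homogeneous element is a scalar times a monomial; a
  nonzero scalar is removed by its inverse in \<open>K\<close>.\<close>

lemma (in ring) mem_indexed_pset_iff:
  "P \<in> indexed_pset V (carrier R) \<longleftrightarrow>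
    (\<forall>n. P n \<in> carrier R) \<and> finite {n. P n \<noteq> \<zero>} \<and> (\<forall>n. P n \<noteq> \<zero> \<longrightarrow> set_mset n \<subseteq> V)"
  (is "_ \<longleftrightarrow> ?r P")
proof
  assume "P \<in> indexed_pset V (carrier R)"
  then show "?r P"
  proof induction
    case (indexed_const k)
    have "{n. indexed_const k n \<noteq> \<zero>} \<subseteq> {{#}}" for n :: "'c multiset"
      by (auto simp: indexed_const_def)
    then show ?case
      using indexed_const by (auto simp: indexed_const_def intro: finite_subset)
  next
    case (indexed_padd P Q)
    have "{n. (P \<Oplus> Q) n \<noteq> \<zero>} \<subseteq> {n. P n \<noteq> \<zero>} \<union> {n. Q n \<noteq> \<zero>}"
      by (auto simp: indexed_padd_def)
    then have "finite {n. (P \<Oplus> Q) n \<noteq> \<zero>}"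
      using indexed_padd by (blast intro: finite_subset finite_UnI)
    moreover have "set_mset n \<subseteq> V" if "(P \<Oplus> Q) n \<noteq> \<zero>" for n
      using that indexed_padd by (cases "P n = \<zero>") (auto simp: indexed_padd_def)
    ultimately show ?case
      using indexed_padd by (auto simp: indexed_padd_def)
  next
    case (indexed_pmult P i)
    have "{n. (P \<Otimes> i) n \<noteq> \<zero>} \<subseteq> add_mset i ` {n. P n \<noteq> \<zero>}"
      by (force simp: indexed_pmult_def split: if_splits intro: image_eqI[of _ _ "_ - {#i#}"])
    then have "finite {n. (P \<Otimes> i) n \<noteq> \<zero>}"
      using indexed_pmult by (blast intro: finite_subset finite_imageI)
    moreover have "set_mset n \<subseteq> V" if "(P \<Otimes> i) n \<noteq> \<zero>" for n
    proof -
      from that have "i \<in># n" "P (n - {#i#}) \<noteq> \<zero>"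
        by (auto simp: indexed_pmult_def split: if_splits)
      moreover from this have "set_mset (n - {#i#}) \<subseteq> V"
        using indexed_pmult by blast
      moreover from \<open>i \<in># n\<close> have "set_mset n = insert i (set_mset (n - {#i#}))"
        by (metis insert_DiffM set_mset_add_mset_insert)
      ultimately show ?thesis
        using indexed_pmult by auto
    qed
    ultimately show ?case
      using indexed_pmult by (auto simp: indexed_pmult_def)
  qed
next
  \<comment> \<open>For the converse, a polynomial of finite support is the sum of its terms. A
    single term is reached from a constant by multiplying with its variables one at a time, the only
    product in the inductive definition of \<open>indexed_pset\<close>.\<close>
  have mon: "(\<lambda>k. if k = n then c else \<zero>) \<in> indexed_pset V (carrier R)"
    if "c \<in> carrier R" "set_mset n \<subseteq> V" for n :: "'c multiset" and c
    using that(2)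
  proof (induction n)
    case empty
    show ?case
      using indexed_pset.indexed_const[OF that(1)] by (simp add: indexed_const_def)
  next
    case (add x n)
    then have "(\<lambda>k. if k = n then c else \<zero>) \<Otimes> x \<in> indexed_pset V (carrier R)"
      by (intro indexed_pset.indexed_pmult) auto
    also have "(\<lambda>k. if k = n then c else \<zero>) \<Otimes> x = (\<lambda>k. if k = add_mset x n then c else \<zero>)"
      by (auto simp: indexed_pmult_def fun_eq_iff dest: multi_member_split)
    finally show ?case .
  qed
  have "P \<in> indexed_pset V (carrier R)"
    if "finite F" "{n. P n \<noteq> \<zero>} = F" "\<And>n. P n \<in> carrier R" "\<And>n. P n \<noteq> \<zero> \<Longrightarrow> set_mset n \<subseteq> V" for F P
    using that
  proof (induction F arbitrary: P rule: finite_induct)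
    case empty
    then have "P = indexed_const \<zero>"
      by (auto simp: indexed_const_def fun_eq_iff)
    then show ?case
      by (auto intro: indexed_pset.indexed_const)
  next
    case (insert n F)
    then have n: "P n \<noteq> \<zero>" by auto
    have "P(n := \<zero>) \<in> indexed_pset V (carrier R)"
      using insert.prems insert.hyps by (intro insert.IH) (auto split: if_splits)
    then have "P(n := \<zero>) \<Oplus> (\<lambda>k. if k = n then P n else \<zero>) \<in> indexed_pset V (carrier R)"
      using insert.prems n by (intro indexed_pset.indexed_padd mon) auto
    also have "P(n := \<zero>) \<Oplus> (\<lambda>k. if k = n then P n else \<zero>) = P"
      using insert.prems by (auto simp: indexed_padd_def fun_eq_iff)
    finally show ?case .
  qed
  then show "?r P \<Longrightarrow> P \<in> indexed_pset V (carrier R)"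
    by blast
qed

text \<open>Guards the convolution in \<open>mpoly_ring\<close>: \<open>finsum\<close> over an
  infinite index set would be zero by default.\<close>

lemma finite_submultisets: "finite {a. a \<subseteq># n}"
proof (induction n)
  case (add x n)
  have "{a. a \<subseteq># add_mset x n} \<subseteq> {a. a \<subseteq># n} \<union> add_mset x ` {a. a \<subseteq># n}"
  proof
    fix a assume a: "a \<in> {a. a \<subseteq># add_mset x n}"
    show "a \<in> {a. a \<subseteq># n} \<union> add_mset x ` {a. a \<subseteq># n}"
    proof (cases "x \<in># a")
      case True
      then obtain b where "a = add_mset x b"
        by (meson multi_member_split)
      with a show ?thesis
        by simp
    next
      case False
      then have "count a y \<le> count n y" for y
        using mset_subset_eq_count[of a "add_mset x n" y] a
        by (cases "y = x") (auto simp: not_in_iff)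
      then show ?thesis
        by (simp add: subseteq_mset_def)
    qed
  qed
  then show ?case
    using add by (auto intro: finite_subset)
qed auto

lemma submultiset_diff_diff: "a \<subseteq># n \<Longrightarrow> n - (n - a) = a"
  by (intro multiset_eqI) (auto simp: subseteq_mset_def)

section \<open>The polynomial ring \<open>T\<close> as a commutative ring\<close>

context cring
begin

lemma mpoly_ring_simps:
  "carrier (mpoly_ring R V) = indexed_pset V (carrier R)"
  "\<zero>\<^bsub>mpoly_ring R V\<^esub> = indexed_const \<zero>"
  "\<one>\<^bsub>mpoly_ring R V\<^esub> = indexed_const \<one>"
  "P \<oplus>\<^bsub>mpoly_ring R V\<^esub> Q = P \<Oplus> Q"
  by (auto simp: mpoly_ring_def)

lemma mpoly_mult_coeff:
  "(P \<otimes>\<^bsub>mpoly_ring R V\<^esub> Q) n = (\<Oplus>a\<in>{a. a \<subseteq># n}. P a \<otimes> Q (n - a))"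
  by (auto simp: mpoly_ring_def)

lemma mpoly_coeff_closed: "P \<in> carrier (mpoly_ring R V) \<Longrightarrow> P n \<in> carrier R"
  by (simp add: mpoly_ring_simps mem_indexed_pset_iff)

text \<open>Only the factorisation of \<open>n\<close> with empty cofactor contributes. Together
  with \<open>mpoly_mult_pmult\<close> and \<open>mpoly_mult_padd\<close> this describes the product
  recursively in its right factor, so that closure and associativity follow by induction on that
  factor, without reindexing iterated convolutions.\<close>

lemma mpoly_mult_const:
  assumes "P \<in> carrier (mpoly_ring R V)" "c \<in> carrier R"
  shows "P \<otimes>\<^bsub>mpoly_ring R V\<^esub> indexed_const c = (\<lambda>n. P n \<otimes> c)"
proof
  fix n
  have "(P \<otimes>\<^bsub>mpoly_ring R V\<^esub> indexed_const c) n
      = (\<Oplus>a\<in>{a. a \<subseteq># n}. if n = a then P a \<otimes> c else \<zero>)"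
    unfolding mpoly_mult_coeff using assms mpoly_coeff_closed[OF assms(1)]
    by (intro finsum_cong')
      (auto simp: indexed_const_def Diff_eq_empty_iff_mset dest: subset_mset.antisym)
  also have "\<dots> = P n \<otimes> c"
    using mpoly_coeff_closed[OF assms(1)] assms(2)
    by (intro finsum_singleton) (auto simp: finite_submultisets)
  finally show "(P \<otimes>\<^bsub>mpoly_ring R V\<^esub> indexed_const c) n = P n \<otimes> c" .
qed

text \<open>At a monomial without \<open>i\<close> both sides vanish. At \<open>add_mset i m\<close>
  the factorisations that contribute are those which leave a copy of \<open>i\<close> to the
  cofactor, that is, the factorisations of \<open>m\<close>.\<close>

lemma mpoly_mult_pmult:
  assumes P: "P \<in> carrier (mpoly_ring R V)" and Q: "Q \<in> carrier (mpoly_ring R V)"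
  shows "P \<otimes>\<^bsub>mpoly_ring R V\<^esub> (Q \<Otimes> i) = (P \<otimes>\<^bsub>mpoly_ring R V\<^esub> Q) \<Otimes> i"
proof
  fix n
  note [simp] = mpoly_coeff_closed[OF P] mpoly_coeff_closed[OF Q]
  show "(P \<otimes>\<^bsub>mpoly_ring R V\<^esub> (Q \<Otimes> i)) n = ((P \<otimes>\<^bsub>mpoly_ring R V\<^esub> Q) \<Otimes> i) n"
  proof (cases "i \<in># n")
    case False
    then have "i \<notin># n - a" for a
      by (meson in_diffD)
    then have "(P \<otimes>\<^bsub>mpoly_ring R V\<^esub> (Q \<Otimes> i)) n = (\<Oplus>a\<in>{a. a \<subseteq># n}. \<zero>)"
      unfolding mpoly_mult_coeff by (intro finsum_cong') (auto simp: indexed_pmult_def)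
    then show ?thesis
      using False by (simp add: indexed_pmult_def)
  next
    case True
    then obtain m where n: "n = add_mset i m"
      by (meson multi_member_split)
    have "(P \<otimes>\<^bsub>mpoly_ring R V\<^esub> (Q \<Otimes> i)) n = (\<Oplus>a\<in>{a. a \<subseteq># m}. P a \<otimes> Q (m - a))"
      unfolding mpoly_mult_coeff
    proof (rule add.finprod_mono_neutral_cong)
      \<comment> \<open>A submultiset of \<open>n\<close> that is not one of \<open>m\<close> uses
        up every copy of \<open>i\<close>, so the cofactor contains none.\<close>
      show "P a \<otimes> (Q \<Otimes> i) (n - a) = \<zero>" if "a \<in> {a. a \<subseteq># n} - {a. a \<subseteq># m}" for a
      proof -
        have "count a i = count n i"
          using that by (auto simp: subseteq_mset_def n not_le le_Suc_eq split: if_splits)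
        then have "i \<notin># n - a"
          by (simp add: in_diff_count)
        then show ?thesis
          by (simp add: indexed_pmult_def)
      qed
      show "P a \<otimes> (Q \<Otimes> i) (n - a) = P a \<otimes> Q (m - a)" if "a \<in> {a. a \<subseteq># n} \<inter> {a. a \<subseteq># m}" for a
      proof -
        from that obtain c where "m = a + c"
          by (auto simp: mset_subset_eq_exists_conv)
        then show ?thesis
          by (simp add: indexed_pmult_def n)
      qed
      show "P a \<otimes> Q (m - a) = \<zero>" if "a \<in> {a. a \<subseteq># m} - {a. a \<subseteq># n}" for a
        using that subset_mset.order_trans[of a m n] by (simp add: n)
    qed (auto simp: finite_submultisets indexed_pmult_def)
    also have "\<dots> = ((P \<otimes>\<^bsub>mpoly_ring R V\<^esub> Q) \<Otimes> i) n"
      by (simp add: indexed_pmult_def n mpoly_mult_coeff)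
    finally show ?thesis .
  qed
qed

lemma mpoly_mult_comm:
  fixes P :: "'v multiset \<Rightarrow> 'a"
  assumes P: "P \<in> carrier (mpoly_ring R V)" and Q: "Q \<in> carrier (mpoly_ring R V)"
  shows "P \<otimes>\<^bsub>mpoly_ring R V\<^esub> Q = Q \<otimes>\<^bsub>mpoly_ring R V\<^esub> P"
proof
  fix n :: "'v multiset"
  note [simp] = mpoly_coeff_closed[OF P] mpoly_coeff_closed[OF Q]
  have inj: "inj_on ((-) n) {a. a \<subseteq># n}"
    by (metis submultiset_diff_diff inj_on_inverseI mem_Collect_eq)
  have im: "(-) n ` {a. a \<subseteq># n} = {a. a \<subseteq># n}"
  proof (intro equalityI subsetI)
    fix a assume "a \<in> {a. a \<subseteq># n}"
    then show "a \<in> (-) n ` {a. a \<subseteq># n}"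
      by (intro image_eqI[of _ _ "n - a"]) (auto simp: submultiset_diff_diff)
  qed auto
  have "(P \<otimes>\<^bsub>mpoly_ring R V\<^esub> Q) n = (\<Oplus>a\<in>(-) n ` {a. a \<subseteq># n}. P a \<otimes> Q (n - a))"
    by (simp add: im mpoly_mult_coeff)
  also have "\<dots> = (\<Oplus>a\<in>{a. a \<subseteq># n}. P (n - a) \<otimes> Q (n - (n - a)))"
    by (intro finsum_reindex inj) auto
  also have "\<dots> = (Q \<otimes>\<^bsub>mpoly_ring R V\<^esub> P) n"
    unfolding mpoly_mult_coeff
    by (intro finsum_cong') (auto simp: m_comm submultiset_diff_diff)
  finally show "(P \<otimes>\<^bsub>mpoly_ring R V\<^esub> Q) n = (Q \<otimes>\<^bsub>mpoly_ring R V\<^esub> P) n" .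
qed

lemma mpoly_mult_padd:
  assumes "P \<in> carrier (mpoly_ring R V)" "Q \<in> carrier (mpoly_ring R V)" "S \<in> carrier (mpoly_ring R V)"
  shows "P \<otimes>\<^bsub>mpoly_ring R V\<^esub> (Q \<Oplus> S) = (P \<otimes>\<^bsub>mpoly_ring R V\<^esub> Q) \<Oplus> (P \<otimes>\<^bsub>mpoly_ring R V\<^esub> S)"
proof
  fix n
  note [simp] = assms[THEN mpoly_coeff_closed]
  have "(P \<otimes>\<^bsub>mpoly_ring R V\<^esub> (Q \<Oplus> S)) n
      = (\<Oplus>a\<in>{a. a \<subseteq># n}. P a \<otimes> Q (n - a) \<oplus> P a \<otimes> S (n - a))"
    unfolding mpoly_mult_coeff by (intro finsum_cong') (auto simp: indexed_padd_def r_distr)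
  also have "\<dots> = ((P \<otimes>\<^bsub>mpoly_ring R V\<^esub> Q) \<Oplus> (P \<otimes>\<^bsub>mpoly_ring R V\<^esub> S)) n"
    by (simp add: indexed_padd_def mpoly_mult_coeff finsum_addf Pi_def)
  finally show "(P \<otimes>\<^bsub>mpoly_ring R V\<^esub> (Q \<Oplus> S)) n
    = ((P \<otimes>\<^bsub>mpoly_ring R V\<^esub> Q) \<Oplus> (P \<otimes>\<^bsub>mpoly_ring R V\<^esub> S)) n" .
qed

lemma mpoly_mult_closed:
  assumes P: "P \<in> carrier (mpoly_ring R V)" and Q: "Q \<in> carrier (mpoly_ring R V)"
  shows "P \<otimes>\<^bsub>mpoly_ring R V\<^esub> Q \<in> carrier (mpoly_ring R V)"
  using Q unfolding mpoly_ring_simps(1)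
proof induction
  case (indexed_const c)
  have "finite {n. P n \<otimes> c \<noteq> \<zero>}"
    by (rule finite_subset[of _ "{n. P n \<noteq> \<zero>}"])
      (use P indexed_const in \<open>auto simp: mpoly_ring_simps mem_indexed_pset_iff\<close>)
  moreover have "P n \<otimes> c \<noteq> \<zero> \<Longrightarrow> P n \<noteq> \<zero>" for n
    using indexed_const by auto
  ultimately show ?case
    using P indexed_const by (simp add: mpoly_mult_const[OF P]) (simp add: mpoly_ring_simps mem_indexed_pset_iff)
next
  case (indexed_padd Q S)
  then show ?case
    using mpoly_mult_padd[OF P, of Q S] by (simp add: mpoly_ring_simps indexed_pset.indexed_padd)
next
  case (indexed_pmult Q i)
  then show ?case
    using mpoly_mult_pmult[OF P, of Q i] by (simp add: mpoly_ring_simps indexed_pset.indexed_pmult)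
qed

lemma mpoly_mult_assoc:
  assumes P: "P \<in> carrier (mpoly_ring R V)" and Q: "Q \<in> carrier (mpoly_ring R V)"
    and S: "S \<in> carrier (mpoly_ring R V)"
  shows "P \<otimes>\<^bsub>mpoly_ring R V\<^esub> Q \<otimes>\<^bsub>mpoly_ring R V\<^esub> S = P \<otimes>\<^bsub>mpoly_ring R V\<^esub> (Q \<otimes>\<^bsub>mpoly_ring R V\<^esub> S)"
  using S unfolding mpoly_ring_simps(1)
proof induction
  case (indexed_const c)
  note PQ = mpoly_mult_closed[OF P Q]
  have Qc: "Q \<otimes>\<^bsub>mpoly_ring R V\<^esub> indexed_const c \<in> carrier (mpoly_ring R V)"
    using indexed_const Q by (intro mpoly_mult_closed) (auto simp: mpoly_ring_simps intro: indexed_pset.indexed_const)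
  note [simp] = mpoly_coeff_closed[OF P] mpoly_coeff_closed[OF Q]
  show ?case
    unfolding mpoly_mult_const[OF PQ indexed_const] mpoly_mult_const[OF Q indexed_const]
    using indexed_const
    by (auto simp: mpoly_mult_coeff fun_eq_iff finsum_ldistr finite_submultisets Pi_def m_assoc intro!: finsum_cong')
next
  case (indexed_padd S T)
  then have ST: "S \<in> carrier (mpoly_ring R V)" "T \<in> carrier (mpoly_ring R V)"
    by (auto simp: mpoly_ring_simps)
  show ?case
    by (simp add: mpoly_mult_padd[OF _ ST] mpoly_mult_padd[OF P] mpoly_mult_closed ST P Q indexed_padd.IH)
next
  case (indexed_pmult S i)
  then have S: "S \<in> carrier (mpoly_ring R V)"
    by (auto simp: mpoly_ring_simps)
  show ?case
    by (simp add: mpoly_mult_pmult[OF _ S] mpoly_mult_pmult[OF P] mpoly_mult_closed S P Q indexed_pmult.IH)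
qed

lemma cring_mpoly_ring: "cring (mpoly_ring R V)"
proof (rule cringI)
  let ?T = "mpoly_ring R V"
  show "abelian_group ?T"
  proof (rule abelian_groupI)
    fix P assume P: "P \<in> carrier ?T"
    then have "(\<lambda>n. \<ominus> P n) \<in> carrier ?T"
      by (auto simp: mpoly_ring_simps mem_indexed_pset_iff)
    moreover have "(\<lambda>n. \<ominus> P n) \<oplus>\<^bsub>?T\<^esub> P = \<zero>\<^bsub>?T\<^esub>"
      using mpoly_coeff_closed[OF P]
      by (auto simp: mpoly_ring_simps indexed_padd_def indexed_const_def l_neg)
    ultimately show "\<exists>Q\<in>carrier ?T. Q \<oplus>\<^bsub>?T\<^esub> P = \<zero>\<^bsub>?T\<^esub>"
      by blast
  next
    fix P assume "P \<in> carrier ?T"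
    from mpoly_coeff_closed[OF this] show "\<zero>\<^bsub>?T\<^esub> \<oplus>\<^bsub>?T\<^esub> P = P"
      by (auto simp: mpoly_ring_simps indexed_padd_def indexed_const_def)
  next
    fix P Q S assume "P \<in> carrier ?T" "Q \<in> carrier ?T" "S \<in> carrier ?T"
    from this[THEN mpoly_coeff_closed]
    show "P \<oplus>\<^bsub>?T\<^esub> Q \<oplus>\<^bsub>?T\<^esub> S = P \<oplus>\<^bsub>?T\<^esub> (Q \<oplus>\<^bsub>?T\<^esub> S)"
      by (auto simp: mpoly_ring_simps indexed_padd_def a_assoc)
  next
    fix P Q assume "P \<in> carrier ?T" "Q \<in> carrier ?T"
    from this[THEN mpoly_coeff_closed]
    show "P \<oplus>\<^bsub>?T\<^esub> Q = Q \<oplus>\<^bsub>?T\<^esub> P"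
      by (auto simp: mpoly_ring_simps indexed_padd_def a_comm)
  qed (auto simp: mpoly_ring_simps intro: indexed_pset.intros)
  have one: "\<one>\<^bsub>?T\<^esub> \<in> carrier ?T"
    by (auto simp: mpoly_ring_simps intro: indexed_pset.intros)
  show "comm_monoid ?T"
  proof (rule comm_monoidI)
    fix P assume P: "P \<in> carrier ?T"
    then show "\<one>\<^bsub>?T\<^esub> \<otimes>\<^bsub>?T\<^esub> P = P"
      using mpoly_coeff_closed[OF P] mpoly_mult_const[OF P, of \<one>]
      by (simp add: mpoly_mult_comm[OF one P]) (simp add: mpoly_ring_simps)
  qed (auto simp: mpoly_mult_closed mpoly_mult_assoc intro: mpoly_mult_comm one)
  fix P Q S assume PQS: "P \<in> carrier ?T" "Q \<in> carrier ?T" "S \<in> carrier ?T"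
  then have "P \<oplus>\<^bsub>?T\<^esub> Q \<in> carrier ?T"
    by (auto simp: mpoly_ring_simps intro: indexed_pset.intros)
  then show "(P \<oplus>\<^bsub>?T\<^esub> Q) \<otimes>\<^bsub>?T\<^esub> S = P \<otimes>\<^bsub>?T\<^esub> S \<oplus>\<^bsub>?T\<^esub> Q \<otimes>\<^bsub>?T\<^esub> S"
    using PQS by (simp add: mpoly_mult_comm[of _ V S]) (simp add: mpoly_mult_padd mpoly_ring_simps(4))
qed

lemma indexed_const_closed: "c \<in> carrier R \<Longrightarrow> indexed_const c \<in> carrier (mpoly_ring R V)"
  by (simp add: mpoly_ring_simps indexed_pset.indexed_const)

lemma indexed_var_closed: "i \<in> V \<Longrightarrow> indexed_var i \<in> carrier (mpoly_ring R V)"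
  by (simp add: mpoly_ring_simps indexed_var_def indexed_pset.intros)

lemma indexed_const_hom: "ring_hom_cring R (mpoly_ring R V) indexed_const"
proof (intro ring_hom_cring.intro ring_hom_cring_axioms.intro ring_hom_memI)
  fix c d assume c: "c \<in> carrier R" and d: "d \<in> carrier R"
  show "indexed_const (c \<otimes> d) = indexed_const c \<otimes>\<^bsub>mpoly_ring R V\<^esub> indexed_const d"
    using c d by (simp add: mpoly_mult_const indexed_const_closed) (auto simp: indexed_const_def)
qed (auto simp: mpoly_ring_simps indexed_padd_const cring_mpoly_ring is_cring
    intro: indexed_pset.indexed_const)

lemma indexed_pmult_eq_mult:
  assumes "P \<in> carrier (mpoly_ring R V)"
  shows "P \<Otimes> i = P \<otimes>\<^bsub>mpoly_ring R V\<^esub> indexed_var i"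
  using assms mpoly_coeff_closed[OF assms]
  by (simp add: indexed_var_def mpoly_mult_pmult indexed_const_closed mpoly_mult_const)

text \<open>The inductive construction of \<open>indexed_pset\<close> in terms of the ring
  operations. The product step multiplies by a single variable, so multiplicative properties need
  only be checked there.\<close>

lemma mpoly_induct [consumes 1, case_names const add mult]:
  assumes "P \<in> carrier (mpoly_ring R V)"
    and "\<And>c. c \<in> carrier R \<Longrightarrow> Prop (indexed_const c)"
    and "\<And>P Q. \<lbrakk>P \<in> carrier (mpoly_ring R V); Q \<in> carrier (mpoly_ring R V); Prop P; Prop Q\<rbrakk>
      \<Longrightarrow> Prop (P \<oplus>\<^bsub>mpoly_ring R V\<^esub> Q)"
    and "\<And>P i. \<lbrakk>P \<in> carrier (mpoly_ring R V); i \<in> V; Prop P\<rbrakk>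
      \<Longrightarrow> Prop (P \<otimes>\<^bsub>mpoly_ring R V\<^esub> indexed_var i)"
  shows "Prop P"
  using assms(1) unfolding mpoly_ring_simps(1)
proof induction
  case (indexed_const k)
  then show ?case by (rule assms(2))
next
  case (indexed_padd P Q)
  then show ?case
    using assms(3)[of P Q] by (simp add: mpoly_ring_simps)
next
  case (indexed_pmult P i)
  then show ?case
    using assms(4)[of P i] indexed_pmult_eq_mult[of P V i] by (simp add: mpoly_ring_simps)
qed

text \<open>The uniqueness half of the universal property of the polynomial ring; existence is
  \<open>mpoly_eval_hom\<close>.\<close>

lemma mpoly_hom_eqI:
  assumes "P \<in> carrier (mpoly_ring R V)"
    and "g \<in> ring_hom (mpoly_ring R V) S" and "h \<in> ring_hom (mpoly_ring R V) S"
    and "\<And>c. c \<in> carrier R \<Longrightarrow> g (indexed_const c) = h (indexed_const c)"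
    and "\<And>i. i \<in> V \<Longrightarrow> g (indexed_var i) = h (indexed_var i)"
  shows "g P = h P"
  using assms(1)
proof (induction rule: mpoly_induct)
  case (add P Q)
  then show ?case
    by (simp add: ring_hom_add[OF assms(2)] ring_hom_add[OF assms(3)])
next
  case (mult P i)
  then show ?case
    by (simp add: ring_hom_mult[OF assms(2)] ring_hom_mult[OF assms(3)] indexed_var_closed assms(5))
qed (rule assms(4))

lemma finsum_swap:
  assumes "finite A" "finite B" "\<And>i j. i \<in> A \<Longrightarrow> j \<in> B \<Longrightarrow> f i j \<in> carrier R"
  shows "(\<Oplus>i\<in>A. \<Oplus>j\<in>B. f i j) = (\<Oplus>j\<in>B. \<Oplus>i\<in>A. f i j)"
  using assms(1,3)
proof (induction A)
  case (insert x A)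
  then have "(\<Oplus>i\<in>insert x A. \<Oplus>j\<in>B. f i j) = (\<Oplus>j\<in>B. f x j) \<oplus> (\<Oplus>j\<in>B. \<Oplus>i\<in>A. f i j)"
    by (simp add: Pi_def)
  also have "\<dots> = (\<Oplus>j\<in>B. f x j \<oplus> (\<Oplus>i\<in>A. f i j))"
    using insert.prems by (intro finsum_addf[symmetric]) auto
  also have "\<dots> = (\<Oplus>j\<in>B. \<Oplus>i\<in>insert x A. f i j)"
    using insert by (intro finsum_cong') (auto simp: Pi_def)
  finally show ?case .
qed simp

end

section \<open>Evaluation and the universal property of the polynomial ring\<close>

context ring_hom_cring
begin

definition monomial_value :: "('v \<Rightarrow> 'c) \<Rightarrow> 'v multiset \<Rightarrow> 'c"
  where "monomial_value s n = (\<Otimes>\<^bsub>S\<^esub>j\<in>set_mset n. s j [^]\<^bsub>S\<^esub> count n j)"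

lemma monomial_value_closed:
  "s \<in> V \<rightarrow> carrier S \<Longrightarrow> set_mset n \<subseteq> V \<Longrightarrow> monomial_value s n \<in> carrier S"
  unfolding monomial_value_def by (intro S.finprod_closed) auto

lemma monomial_value_add_mset:
  assumes s: "s \<in> V \<rightarrow> carrier S" and i: "i \<in> V" and n: "set_mset n \<subseteq> V"
  shows "monomial_value s (add_mset i n) = monomial_value s n \<otimes>\<^bsub>S\<^esub> s i"
proof -
  let ?F = "set_mset (add_mset i n)"
  have sF: "s j \<in> carrier S" if "j \<in> ?F" for j
    using that assms by auto
  \<comment> \<open>The additional factor \<open>s i\<close> is written as a product over the same
    index set, with one at the other places, so that the two products separate. If \<open>i\<close>
    does not occur in \<open>n\<close>, the first product then has the factor \<open>s i\<close> to
    the power zero there, which is dropped at the end.\<close>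
  have "monomial_value s (add_mset i n)
      = (\<Otimes>\<^bsub>S\<^esub>j\<in>?F. s j [^]\<^bsub>S\<^esub> count n j \<otimes>\<^bsub>S\<^esub> (if i = j then s j else \<one>\<^bsub>S\<^esub>))"
    unfolding monomial_value_def using sF by (intro S.finprod_cong') auto
  also have "\<dots> = (\<Otimes>\<^bsub>S\<^esub>j\<in>?F. s j [^]\<^bsub>S\<^esub> count n j)
      \<otimes>\<^bsub>S\<^esub> (\<Otimes>\<^bsub>S\<^esub>j\<in>?F. if i = j then s j else \<one>\<^bsub>S\<^esub>)"
    using sF by (intro S.finprod_multf) auto
  also have "(\<Otimes>\<^bsub>S\<^esub>j\<in>?F. if i = j then s j else \<one>\<^bsub>S\<^esub>) = s i"
    using sF by (intro S.finprod_singleton) auto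
  also have "(\<Otimes>\<^bsub>S\<^esub>j\<in>?F. s j [^]\<^bsub>S\<^esub> count n j) = monomial_value s n"
    unfolding monomial_value_def using sF
    by (intro S.finprod_mono_neutral_cong_right) (auto simp: not_in_iff)
  finally show ?thesis .
qed

text \<open>The supports of \<open>P\<close>, \<open>Q\<close> and their sum may differ because of
  cancellation. Comparing values needs one finite index set that contains all of them.\<close>

lemma mpoly_eval_superset:
  assumes s: "s \<in> V \<rightarrow> carrier S" and P: "P \<in> carrier (mpoly_ring R V)"
    and "finite F" "{n. P n \<noteq> \<zero>} \<subseteq> F" "\<And>n. n \<in> F \<Longrightarrow> set_mset n \<subseteq> V"
  shows "mpoly_eval R S h s P = (\<Oplus>\<^bsub>S\<^esub>n\<in>F. h (P n) \<otimes>\<^bsub>S\<^esub> monomial_value s n)"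
  unfolding mpoly_eval_def monomial_value_def[symmetric]
  using assms R.mpoly_coeff_closed[OF P] monomial_value_closed[OF s]
  by (intro S.add.finprod_mono_neutral_cong_left) auto

lemma mpoly_eval_closed:
  assumes s: "s \<in> V \<rightarrow> carrier S" and P: "P \<in> carrier (mpoly_ring R V)"
  shows "mpoly_eval R S h s P \<in> carrier S"
  unfolding mpoly_eval_def monomial_value_def[symmetric]
  using P R.mpoly_coeff_closed[OF P] monomial_value_closed[OF s]
  by (intro S.finsum_closed) (auto simp: R.mpoly_ring_simps R.mem_indexed_pset_iff)

lemma mpoly_eval_const:
  assumes s: "s \<in> V \<rightarrow> carrier S" and c: "c \<in> carrier R"
  shows "mpoly_eval R S h s (R.indexed_const c) = h c"
proof -
  have "mpoly_eval R S h s (R.indexed_const c)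
      = (\<Oplus>\<^bsub>S\<^esub>n\<in>{{#}}. h (R.indexed_const c n) \<otimes>\<^bsub>S\<^esub> monomial_value s n)"
    using c by (intro mpoly_eval_superset[OF s] R.indexed_const_closed)
      (auto simp: R.indexed_const_def)
  then show ?thesis
    using c by (simp add: monomial_value_def R.indexed_const_def)
qed

lemma mpoly_eval_add:
  assumes s: "s \<in> V \<rightarrow> carrier S"
    and P: "P \<in> carrier (mpoly_ring R V)" and Q: "Q \<in> carrier (mpoly_ring R V)"
  shows "mpoly_eval R S h s (P \<oplus>\<^bsub>mpoly_ring R V\<^esub> Q) = mpoly_eval R S h s P \<oplus>\<^bsub>S\<^esub> mpoly_eval R S h s Q"
proof -
  interpret T: cring "mpoly_ring R V" by (rule R.cring_mpoly_ring)
  define F where "F = {n. P n \<noteq> \<zero>} \<union> {n. Q n \<noteq> \<zero>}"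
  have F: "finite F" "\<And>n. n \<in> F \<Longrightarrow> set_mset n \<subseteq> V"
    using P Q by (auto simp: F_def R.mpoly_ring_simps R.mem_indexed_pset_iff)
  note cl = R.mpoly_coeff_closed[OF P] R.mpoly_coeff_closed[OF Q] monomial_value_closed[OF s F(2)]
  have "mpoly_eval R S h s (P \<oplus>\<^bsub>mpoly_ring R V\<^esub> Q)
      = (\<Oplus>\<^bsub>S\<^esub>n\<in>F. h ((P \<oplus>\<^bsub>mpoly_ring R V\<^esub> Q) n) \<otimes>\<^bsub>S\<^esub> monomial_value s n)"
    by (intro mpoly_eval_superset[OF s] T.a_closed P Q F)
      (auto simp: F_def R.mpoly_ring_simps R.indexed_padd_def)
  also have "\<dots> = (\<Oplus>\<^bsub>S\<^esub>n\<in>F. h (P n) \<otimes>\<^bsub>S\<^esub> monomial_value s n \<oplus>\<^bsub>S\<^esub> h (Q n) \<otimes>\<^bsub>S\<^esub> monomial_value s n)"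
    using cl by (intro S.finsum_cong') (auto simp: R.mpoly_ring_simps R.indexed_padd_def S.l_distr)
  also have "\<dots> = (\<Oplus>\<^bsub>S\<^esub>n\<in>F. h (P n) \<otimes>\<^bsub>S\<^esub> monomial_value s n)
      \<oplus>\<^bsub>S\<^esub> (\<Oplus>\<^bsub>S\<^esub>n\<in>F. h (Q n) \<otimes>\<^bsub>S\<^esub> monomial_value s n)"
    using cl by (intro S.finsum_addf) auto
  also have "\<dots> = mpoly_eval R S h s P \<oplus>\<^bsub>S\<^esub> mpoly_eval R S h s Q"
    using F by (subst (1 2) mpoly_eval_superset[OF s, of _ F]) (auto simp: P Q F_def)
  finally show ?thesis .
qed

lemma mpoly_eval_mult_var:
  assumes s: "s \<in> V \<rightarrow> carrier S" and P: "P \<in> carrier (mpoly_ring R V)" and i: "i \<in> V"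
  shows "mpoly_eval R S h s (P \<otimes>\<^bsub>mpoly_ring R V\<^esub> R.indexed_var i) = mpoly_eval R S h s P \<otimes>\<^bsub>S\<^esub> s i"
proof -
  interpret T: cring "mpoly_ring R V" by (rule R.cring_mpoly_ring)
  let ?Q = "P \<otimes>\<^bsub>mpoly_ring R V\<^esub> R.indexed_var i"
  define F where "F = {n. P n \<noteq> \<zero>}"
  have F: "finite F" "\<And>n. n \<in> F \<Longrightarrow> set_mset n \<subseteq> V"
    using P by (auto simp: F_def R.mpoly_ring_simps R.mem_indexed_pset_iff)
  note cl = R.mpoly_coeff_closed[OF P] monomial_value_closed[OF s F(2)]
  have Q: "?Q n = (if i \<in># n then P (n - {#i#}) else \<zero>)" for n
    by (simp flip: R.indexed_pmult_eq_mult[OF P]) (simp add: R.indexed_pmult_def)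
  have si: "s i \<in> carrier S"
    using s i by auto
  have iF: "set_mset n \<subseteq> V" if "n \<in> add_mset i ` F" for n
    using that i F(2) by fastforce
  have "mpoly_eval R S h s ?Q = (\<Oplus>\<^bsub>S\<^esub>n\<in>add_mset i ` F. h (?Q n) \<otimes>\<^bsub>S\<^esub> monomial_value s n)"
    using F(1) i P
    by (intro mpoly_eval_superset[OF s] T.m_closed R.indexed_var_closed iF)
      (auto simp: F_def Q image_iff split: if_splits dest!: multi_member_split)
  also have "\<dots> = (\<Oplus>\<^bsub>S\<^esub>n\<in>F. h (?Q (add_mset i n)) \<otimes>\<^bsub>S\<^esub> monomial_value s (add_mset i n))"
    using cl si by (intro S.finsum_reindex) (auto simp: Q inj_on_def monomial_value_add_mset[OF s i F(2)])
  also have "\<dots> = (\<Oplus>\<^bsub>S\<^esub>n\<in>F. h (P n) \<otimes>\<^bsub>S\<^esub> monomial_value s n \<otimes>\<^bsub>S\<^esub> s i)"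
    using cl si
    by (intro S.finsum_cong') (auto simp: Q monomial_value_add_mset[OF s i F(2)] S.m_assoc)
  also have "\<dots> = (\<Oplus>\<^bsub>S\<^esub>n\<in>F. h (P n) \<otimes>\<^bsub>S\<^esub> monomial_value s n) \<otimes>\<^bsub>S\<^esub> s i"
    using cl si F by (intro S.finsum_ldistr[symmetric]) auto
  also have "\<dots> = mpoly_eval R S h s P \<otimes>\<^bsub>S\<^esub> s i"
    using F by (subst mpoly_eval_superset[OF s P, of F]) (auto simp: F_def)
  finally show ?thesis .
qed

lemma mpoly_eval_mult_const:
  assumes s: "s \<in> V \<rightarrow> carrier S" and P: "P \<in> carrier (mpoly_ring R V)" and c: "c \<in> carrier R"
  shows "mpoly_eval R S h s (P \<otimes>\<^bsub>mpoly_ring R V\<^esub> R.indexed_const c) = mpoly_eval R S h s P \<otimes>\<^bsub>S\<^esub> h c"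
  using P
proof (induction rule: R.mpoly_induct)
  case (const d)
  interpret C: ring_hom_cring R "mpoly_ring R V" R.indexed_const
    by (rule R.indexed_const_hom)
  show ?case
    using const c by (simp flip: C.hom_mult add: mpoly_eval_const[OF s])
next
  case (add P Q)
  interpret T: cring "mpoly_ring R V" by (rule R.cring_mpoly_ring)
  note cc = R.indexed_const_closed[OF c, of V]
  show ?case
    using add cc c by (simp add: T.l_distr mpoly_eval_add[OF s] mpoly_eval_closed[OF s] S.l_distr)
next
  case (mult P i)
  interpret T: cring "mpoly_ring R V" by (rule R.cring_mpoly_ring)
  note cc = R.indexed_const_closed[OF c, of V] and v = R.indexed_var_closed[OF mult(2)]
  have "P \<otimes>\<^bsub>mpoly_ring R V\<^esub> R.indexed_var i \<otimes>\<^bsub>mpoly_ring R V\<^esub> R.indexed_const c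
      = P \<otimes>\<^bsub>mpoly_ring R V\<^esub> R.indexed_const c \<otimes>\<^bsub>mpoly_ring R V\<^esub> R.indexed_var i"
    using mult cc v by (simp add: T.m_ac)
  moreover have "s i \<in> carrier S" using s mult(2) by auto
  ultimately show ?case
    using mult cc v c by (simp add: mpoly_eval_mult_var[OF s] mpoly_eval_closed[OF s] S.m_ac)
qed

text \<open>Multiplicativity goes by induction on the right factor. The cases of a constant and of a
  multiple of a variable are the two preceding product rules; sums are distributivity.\<close>

lemma mpoly_eval_hom:
  assumes s: "s \<in> V \<rightarrow> carrier S"
  shows "ring_hom_cring (mpoly_ring R V) S (mpoly_eval R S h s)"
proof (intro ring_hom_cring.intro ring_hom_cring_axioms.intro ring_hom_memI)
  interpret T: cring "mpoly_ring R V" by (rule R.cring_mpoly_ring)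
  show "mpoly_eval R S h s \<one>\<^bsub>mpoly_ring R V\<^esub> = \<one>\<^bsub>S\<^esub>"
    by (simp add: R.mpoly_ring_simps mpoly_eval_const[OF s])
  fix P Q assume P: "P \<in> carrier (mpoly_ring R V)" and Q: "Q \<in> carrier (mpoly_ring R V)"
  show "mpoly_eval R S h s (P \<otimes>\<^bsub>mpoly_ring R V\<^esub> Q) = mpoly_eval R S h s P \<otimes>\<^bsub>S\<^esub> mpoly_eval R S h s Q"
    using Q
  proof (induction rule: R.mpoly_induct)
    case (const c)
    then show ?case
      by (simp add: mpoly_eval_mult_const[OF s P] mpoly_eval_const[OF s])
  next
    case (add Q Q')
    then show ?case
      using P by (simp add: T.r_distr mpoly_eval_add[OF s] mpoly_eval_closed[OF s] S.r_distr)
  next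
    case (mult Q i)
    moreover have "s i \<in> carrier S" using s mult(2) by auto
    ultimately show ?case
      using P R.indexed_var_closed[OF mult(2)]
      by (simp add: mpoly_eval_mult_var[OF s] mpoly_eval_closed[OF s] S.m_assoc flip: T.m_assoc)
  qed
qed (use assms in \<open>auto simp: mpoly_eval_closed mpoly_eval_add R.cring_mpoly_ring S.is_cring\<close>)

lemma mpoly_eval_var:
  assumes s: "s \<in> V \<rightarrow> carrier S" and i: "i \<in> V"
  shows "mpoly_eval R S h s (R.indexed_var i) = s i"
proof -
  interpret T: cring "mpoly_ring R V" by (rule R.cring_mpoly_ring)
  have "s i \<in> carrier S" using s i by auto
  then show ?thesis
    using mpoly_eval_mult_var[OF s T.one_closed i] R.indexed_var_closed[OF i]
      mpoly_eval_const[OF s R.one_closed]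
    by (simp add: R.mpoly_ring_simps(3)[symmetric, of V])
qed

end

section \<open>Independence of the conductor from the generators\<close>

context cring
begin

text \<open>The usual reason why congruences modulo an ideal multiply: if \<open>b - y\<close> and
  \<open>a - x\<close> lie in the ideal, so does the right-hand side. It carries the comparison of a
  substitution with the identity from \<open>P\<close> to \<open>P\<close> times a variable.\<close>

lemma mult_diff_split:
  assumes "a \<in> carrier R" "b \<in> carrier R" "x \<in> carrier R" "y \<in> carrier R"
  shows "a \<otimes> b \<ominus> x \<otimes> y = a \<otimes> (b \<ominus> y) \<oplus> (a \<ominus> x) \<otimes> y"
proof -
  have "a \<otimes> (b \<ominus> y) \<oplus> (a \<ominus> x) \<otimes> y
      = a \<otimes> b \<oplus> (\<ominus> (a \<otimes> y) \<oplus> (a \<otimes> y \<oplus> \<ominus> (x \<otimes> y)))"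
    using assms by (simp add: a_minus_def r_distr l_distr r_minus l_minus a_assoc)
  then show ?thesis
    using assms by (simp add: a_minus_def r_neg1)
qed

lemma mult_minus_mult_diff:
  assumes "a \<in> carrier R" "x \<in> carrier R" "y \<in> carrier R"
  shows "a \<otimes> y = a \<otimes> x \<ominus> a \<otimes> (x \<ominus> y)"
proof -
  have "a \<otimes> x \<ominus> a \<otimes> (x \<ominus> y) = a \<otimes> x \<oplus> (\<ominus> (a \<otimes> x) \<oplus> a \<otimes> y)"
    using assms by (simp add: a_minus_def r_distr r_minus minus_add)
  then show ?thesis
    using assms by (simp add: r_neg2)
qed

lemma ideal_if_closed:
  assumes "I \<subseteq> carrier R" "\<zero> \<in> I"
    and "\<And>x y. x \<in> I \<Longrightarrow> y \<in> I \<Longrightarrow> x \<oplus> y \<in> I"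
    and mult: "\<And>r x. r \<in> carrier R \<Longrightarrow> x \<in> I \<Longrightarrow> r \<otimes> x \<in> I"
  shows "ideal I R"
proof (rule idealI[OF ring_axioms])
  show "subgroup I (add_monoid R)"
  proof (rule add.subgroupI)
    fix x assume "x \<in> I"
    with mult[of "\<ominus> \<one>" x] assms(1) show "\<ominus> x \<in> I"
      by (auto simp: l_minus)
  qed (use assms in auto)
  fix a x assume "a \<in> I" "x \<in> carrier R"
  then show "x \<otimes> a \<in> I" "a \<otimes> x \<in> I"
    using assms(1) mult[of x a] m_comm[of a x] by auto
qed

end

lemma (in ring_hom_cring) ideal_vimage:
  assumes "ideal I S"
  shows "ideal {x \<in> carrier R. h x \<in> I} R"
proof -
  interpret I: ideal I S by fact
  show ?thesis
    by (rule R.ideal_if_closed) (auto simp: I.I_l_closed)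
qed

context cring
begin

text \<open>The combinations form an ideal, and unit vectors of coefficients show that it contains
  each \<open>f i\<close>; minimality does the rest. The coefficients are indexed like the
  generators because they become the rows of substitution matrices.\<close>

lemma genideal_family_combination:
  assumes f: "f \<in> {..<m} \<rightarrow> carrier R" and x: "x \<in> genideal R (f ` {..<m::nat})"
  obtains a where "a \<in> {..<m} \<rightarrow> carrier R" "x = (\<Oplus>i\<in>{..<m}. a i \<otimes> f i)"
proof -
  let ?I = "{(\<Oplus>i\<in>{..<m}. a i \<otimes> f i) | a. a \<in> {..<m} \<rightarrow> carrier R}"
  have "ideal ?I R"
  proof (rule ideal_if_closed)
    show "?I \<subseteq> carrier R"
      using f by (auto intro!: finsum_closed)
    have "(\<Oplus>i\<in>{..<m}. \<zero> \<otimes> f i) = (\<Oplus>i\<in>{..<m}. \<zero>)"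
      using f by (intro finsum_cong') (auto simp: Pi_def)
    then show "\<zero> \<in> ?I"
      by (intro CollectI exI[of _ "\<lambda>_. \<zero>"]) auto
  next
    fix x y assume "x \<in> ?I" "y \<in> ?I"
    then obtain a b where ab: "a \<in> {..<m} \<rightarrow> carrier R" "b \<in> {..<m} \<rightarrow> carrier R"
      and xy: "x = (\<Oplus>i\<in>{..<m}. a i \<otimes> f i)" "y = (\<Oplus>i\<in>{..<m}. b i \<otimes> f i)"
      by blast
    have "(\<Oplus>i\<in>{..<m}. (a i \<oplus> b i) \<otimes> f i) = (\<Oplus>i\<in>{..<m}. a i \<otimes> f i \<oplus> b i \<otimes> f i)"
      using f ab by (intro finsum_cong') (auto simp: l_distr Pi_def)
    also have "\<dots> = x \<oplus> y"
      unfolding xy using f ab by (intro finsum_addf) auto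
    finally show "x \<oplus> y \<in> ?I"
      using ab by (intro CollectI exI[of _ "\<lambda>i. a i \<oplus> b i"]) auto
  next
    fix r x assume r: "r \<in> carrier R" and "x \<in> ?I"
    then obtain a where a: "a \<in> {..<m} \<rightarrow> carrier R" and x: "x = (\<Oplus>i\<in>{..<m}. a i \<otimes> f i)"
      by blast
    have "r \<otimes> x = (\<Oplus>i\<in>{..<m}. r \<otimes> (a i \<otimes> f i))"
      unfolding x using r f a by (intro finsum_rdistr) auto
    also have "\<dots> = (\<Oplus>i\<in>{..<m}. (r \<otimes> a i) \<otimes> f i)"
      using r f a by (intro finsum_cong') (auto simp: m_assoc Pi_def)
    finally show "r \<otimes> x \<in> ?I"
      using r a by (intro CollectI exI[of _ "\<lambda>i. r \<otimes> a i"]) auto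
  qed
  moreover have "f ` {..<m} \<subseteq> ?I"
  proof safe
    fix i assume i: "i < m"
    have "(\<Oplus>j\<in>{..<m}. (if i = j then \<one> else \<zero>) \<otimes> f j) = (\<Oplus>j\<in>{..<m}. if i = j then f j else \<zero>)"
      using f by (intro finsum_cong') (auto simp: Pi_def)
    also have "\<dots> = f i"
      using f i by (intro finsum_singleton) (auto simp: Pi_def)
    finally show "\<exists>a. f i = (\<Oplus>j\<in>{..<m}. a j \<otimes> f j) \<and> a \<in> {..<m} \<rightarrow> carrier R"
      by (intro exI[of _ "\<lambda>j. if i = j then \<one> else \<zero>"]) auto
  qed
  ultimately have "genideal R (f ` {..<m}) \<subseteq> ?I"
    by (rule genideal_minimal)
  with x that show thesis
    by blast
qed

section \<open>Linear forms and the ideal \<open>L\<close>\<close>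

definition linear_form :: "nat \<Rightarrow> (nat \<Rightarrow> 'a) \<Rightarrow> nat multiset \<Rightarrow> 'a"
  where "linear_form m a = (\<Oplus>\<^bsub>mpoly_ring R {..<m}\<^esub>i\<in>{..<m}.
    indexed_const (a i) \<otimes>\<^bsub>mpoly_ring R {..<m}\<^esub> indexed_var i)"

lemma linear_relations_eq:
  "linear_relations R m f = {linear_form m a | a.
    a \<in> {..<m} \<rightarrow> carrier R \<and> (\<Oplus>i\<in>{..<m}. a i \<otimes> f i) = \<zero>}"
  by (simp add: linear_relations_def linear_form_def)

lemma linear_form_closed:
  assumes "a \<in> {..<m} \<rightarrow> carrier R"
  shows "linear_form m a \<in> carrier (mpoly_ring R {..<m})"
proof -
  interpret T: cring "mpoly_ring R {..<m}" by (rule cring_mpoly_ring)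
  show ?thesis
    unfolding linear_form_def using assms
    by (intro T.finsum_closed) (auto intro!: T.m_closed indexed_const_closed indexed_var_closed)
qed

lemma linear_form_add:
  assumes a: "a \<in> {..<m} \<rightarrow> carrier R" and b: "b \<in> {..<m} \<rightarrow> carrier R"
  shows "linear_form m a \<oplus>\<^bsub>mpoly_ring R {..<m}\<^esub> linear_form m b = linear_form m (\<lambda>i. a i \<oplus> b i)"
proof -
  interpret T: cring "mpoly_ring R {..<m}" by (rule cring_mpoly_ring)
  interpret C: ring_hom_cring R "mpoly_ring R {..<m}" indexed_const by (rule indexed_const_hom)
  note [simp] = indexed_var_closed[of _ "{..<m}"]
  have "linear_form m (\<lambda>i. a i \<oplus> b i) = (\<Oplus>\<^bsub>mpoly_ring R {..<m}\<^esub>i\<in>{..<m}.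
    indexed_const (a i) \<otimes>\<^bsub>mpoly_ring R {..<m}\<^esub> indexed_var i \<oplus>\<^bsub>mpoly_ring R {..<m}\<^esub>
    indexed_const (b i) \<otimes>\<^bsub>mpoly_ring R {..<m}\<^esub> indexed_var i)"
    unfolding linear_form_def using a b
    by (intro T.finsum_cong') (auto simp: T.l_distr Pi_def)
  also have "\<dots> = linear_form m a \<oplus>\<^bsub>mpoly_ring R {..<m}\<^esub> linear_form m b"
    unfolding linear_form_def using a b by (intro T.finsum_addf) (auto simp: Pi_def)
  finally show ?thesis ..
qed

lemma linear_form_var:
  assumes "i < m"
  shows "linear_form m (\<lambda>j. if i = j then \<one> else \<zero>) = indexed_var i"
proof -
  interpret T: cring "mpoly_ring R {..<m}" by (rule cring_mpoly_ring)
  interpret C: ring_hom_cring R "mpoly_ring R {..<m}" indexed_const by (rule indexed_const_hom)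
  note [simp] = indexed_var_closed[of _ "{..<m}"]
  have "linear_form m (\<lambda>j. if i = j then \<one> else \<zero>)
      = (\<Oplus>\<^bsub>mpoly_ring R {..<m}\<^esub>j\<in>{..<m}. if i = j then indexed_var j else \<zero>\<^bsub>mpoly_ring R {..<m}\<^esub>)"
    unfolding linear_form_def by (intro T.finsum_cong') auto
  also have "\<dots> = indexed_var i"
    using assms by (intro T.finsum_singleton) auto
  finally show ?thesis .
qed

lemma const_mult_linear_form:
  assumes c: "c \<in> carrier R" and a: "a \<in> {..<m} \<rightarrow> carrier R"
  shows "indexed_const c \<otimes>\<^bsub>mpoly_ring R {..<m}\<^esub> linear_form m a = linear_form m (\<lambda>i. c \<otimes> a i)"
proof -
  interpret T: cring "mpoly_ring R {..<m}" by (rule cring_mpoly_ring)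
  interpret C: ring_hom_cring R "mpoly_ring R {..<m}" indexed_const by (rule indexed_const_hom)
  note [simp] = indexed_var_closed[of _ "{..<m}"]
  have "indexed_const c \<otimes>\<^bsub>mpoly_ring R {..<m}\<^esub> linear_form m a = (\<Oplus>\<^bsub>mpoly_ring R {..<m}\<^esub>i\<in>{..<m}.
    indexed_const c \<otimes>\<^bsub>mpoly_ring R {..<m}\<^esub>
      (indexed_const (a i) \<otimes>\<^bsub>mpoly_ring R {..<m}\<^esub> indexed_var i))"
    unfolding linear_form_def using c a by (intro T.finsum_rdistr) (auto simp: Pi_def)
  also have "\<dots> = linear_form m (\<lambda>i. c \<otimes> a i)"
    unfolding linear_form_def using c a
    by (intro T.finsum_cong') (auto simp: T.m_assoc Pi_def)
  finally show ?thesis .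
qed

lemma finsum_linear_form:
  assumes "finite A" "\<And>i. i \<in> A \<Longrightarrow> u i \<in> {..<m} \<rightarrow> carrier R"
  shows "(\<Oplus>\<^bsub>mpoly_ring R {..<m}\<^esub>i\<in>A. linear_form m (u i)) = linear_form m (\<lambda>j. \<Oplus>i\<in>A. u i j)"
  using assms
proof (induction A)
  case empty
  interpret T: cring "mpoly_ring R {..<m}" by (rule cring_mpoly_ring)
  interpret C: ring_hom_cring R "mpoly_ring R {..<m}" indexed_const by (rule indexed_const_hom)
  have "linear_form m (\<lambda>j. \<zero>) = (\<Oplus>\<^bsub>mpoly_ring R {..<m}\<^esub>i\<in>{..<m}. \<zero>\<^bsub>mpoly_ring R {..<m}\<^esub>)"
    unfolding linear_form_def by (intro T.finsum_cong') (auto simp: indexed_var_closed)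
  then show ?case
    by simp
next
  case (insert x A)
  interpret T: cring "mpoly_ring R {..<m}" by (rule cring_mpoly_ring)
  have "(\<Oplus>\<^bsub>mpoly_ring R {..<m}\<^esub>i\<in>insert x A. linear_form m (u i))
      = linear_form m (u x) \<oplus>\<^bsub>mpoly_ring R {..<m}\<^esub> linear_form m (\<lambda>j. \<Oplus>i\<in>A. u i j)"
    using insert by (simp add: linear_form_closed Pi_def)
  also have "\<dots> = linear_form m (\<lambda>j. u x j \<oplus> (\<Oplus>i\<in>A. u i j))"
    using insert by (intro linear_form_add) (auto simp: Pi_def intro!: finsum_closed)
  also have "\<dots> = linear_form m (\<lambda>j. \<Oplus>i\<in>insert x A. u i j)"
    unfolding linear_form_def
    using insert by (intro T.finsum_cong')
      (auto simp: Pi_def intro!: T.m_closed indexed_const_closed indexed_var_closed finsum_closed)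
  finally show ?case .
qed

lemma linear_ideal_ideal:
  "ideal (linear_ideal R m f) (mpoly_ring R {..<m})"
proof -
  interpret T: cring "mpoly_ring R {..<m}" by (rule cring_mpoly_ring)
  show ?thesis
    unfolding linear_ideal_def linear_relations_eq
    by (intro T.genideal_ideal) (auto intro: linear_form_closed)
qed

lemma linear_relation_in_linear_ideal:
  assumes "a \<in> {..<m} \<rightarrow> carrier R" "(\<Oplus>i\<in>{..<m}. a i \<otimes> f i) = \<zero>"
  shows "linear_form m a \<in> linear_ideal R m f"
proof -
  interpret T: cring "mpoly_ring R {..<m}" by (rule cring_mpoly_ring)
  have "linear_relations R m f \<subseteq> linear_ideal R m f"
    unfolding linear_ideal_def
    by (intro T.genideal_self) (auto simp: linear_relations_eq intro: linear_form_closed)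
  then show ?thesis
    using assms by (auto simp: linear_relations_eq)
qed

section \<open>The Rees map and its kernel \<open>J\<close>\<close>

lemma UP_const_hom: "ring_hom_cring R (UP R) (\<lambda>r. up_ring.monom (UP R) r 0)"
proof -
  interpret U: UP_cring R "UP R"
    by (unfold_locales) simp
  show ?thesis
    by unfold_locales (rule U.const_ring_hom)
qed

lemma rees_hom_hom:
  assumes f: "f \<in> {..<m} \<rightarrow> carrier R"
  shows "ring_hom_cring (mpoly_ring R {..<m}) (UP R) (rees_hom R f)"
    and "c \<in> carrier R \<Longrightarrow> rees_hom R f (indexed_const c) = up_ring.monom (UP R) c 0"
    and "i < m \<Longrightarrow> rees_hom R f (indexed_var i) = up_ring.monom (UP R) (f i) 1"
proof -
  interpret U: UP_cring R "UP R"
    by (unfold_locales) simp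
  interpret h: ring_hom_cring R "UP R" "\<lambda>r. up_ring.monom (UP R) r 0"
    by (rule UP_const_hom)
  have s: "(\<lambda>j. up_ring.monom (UP R) (f j) 1) \<in> {..<m} \<rightarrow> carrier (UP R)"
    using f by (auto simp: Pi_def)
  show "ring_hom_cring (mpoly_ring R {..<m}) (UP R) (rees_hom R f)"
    unfolding rees_hom_def by (rule h.mpoly_eval_hom[OF s])
  show "c \<in> carrier R \<Longrightarrow> rees_hom R f (indexed_const c) = up_ring.monom (UP R) c 0"
    unfolding rees_hom_def by (rule h.mpoly_eval_const[OF s])
  show "i < m \<Longrightarrow> rees_hom R f (indexed_var i) = up_ring.monom (UP R) (f i) 1"
    unfolding rees_hom_def using h.mpoly_eval_var[OF s] by simp
qed

text \<open>The Rees algebra shares its zero with \<open>UP R\<close>, so the kernel can be computed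
  with the homomorphism into all of \<open>R[t]\<close>.\<close>

lemma rees_ideal_eq:
  "rees_ideal R m f = {P \<in> carrier (mpoly_ring R {..<m}). rees_hom R f P = \<zero>\<^bsub>UP R\<^esub>}"
  by (simp add: rees_ideal_def a_kernel_def' rees_algebra_def)

text \<open>Makes linear substitutions compatible with the Rees maps: if a generator
  \<open>g j\<close> is the combination of the \<open>f i\<close> with coefficients
  \<open>a\<close>, then the form of \<open>a\<close> has the image \<open>g j t\<close>, which is
  also the image of the variable that belongs to \<open>g j\<close>.\<close>

lemma rees_hom_linear_form:
  assumes f: "f \<in> {..<m} \<rightarrow> carrier R" and a: "a \<in> {..<m} \<rightarrow> carrier R"
  shows "rees_hom R f (linear_form m a) = up_ring.monom (UP R) (\<Oplus>i\<in>{..<m}. a i \<otimes> f i) 1"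
proof -
  interpret U: UP_cring R "UP R"
    by (unfold_locales) simp
  interpret H: ring_hom_cring "mpoly_ring R {..<m}" "UP R" "rees_hom R f"
    by (rule rees_hom_hom[OF f])
  have sum: "up_ring.monom (UP R) (\<Oplus>i\<in>A. b i) 1 = (\<Oplus>\<^bsub>UP R\<^esub>i\<in>A. up_ring.monom (UP R) (b i) 1)"
    if "finite A" "b \<in> A \<rightarrow> carrier R" for A :: "nat set" and b
    using that by (induction A) (auto simp: Pi_def)
  have cl: "indexed_const (a i) \<otimes>\<^bsub>mpoly_ring R {..<m}\<^esub> indexed_var i \<in> carrier (mpoly_ring R {..<m})"
    if "i < m" for i
    using that a by (intro H.R.m_closed indexed_const_closed indexed_var_closed) auto
  have "rees_hom R f (linear_form m a) = (\<Oplus>\<^bsub>UP R\<^esub>i\<in>{..<m}. (rees_hom R f \<circ> (\<lambda>i.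
      indexed_const (a i) \<otimes>\<^bsub>mpoly_ring R {..<m}\<^esub> indexed_var i)) i)"
    unfolding linear_form_def using cl by (intro H.hom_finsum) auto
  also have "\<dots> = (\<Oplus>\<^bsub>UP R\<^esub>i\<in>{..<m}. up_ring.monom (UP R) (a i \<otimes> f i) 1)"
  proof (intro U.finsum_cong')
    fix i assume "i \<in> {..<m}"
    then have i: "i < m" "a i \<in> carrier R" "f i \<in> carrier R"
      using f a by auto
    then have "rees_hom R f (indexed_const (a i) \<otimes>\<^bsub>mpoly_ring R {..<m}\<^esub> indexed_var i)
        = up_ring.monom (UP R) (a i) 0 \<otimes>\<^bsub>UP R\<^esub> up_ring.monom (UP R) (f i) 1"
      by (simp add: indexed_const_closed indexed_var_closed rees_hom_hom[OF f])
    then show "(rees_hom R f \<circ> (\<lambda>i. indexed_const (a i) \<otimes>\<^bsub>mpoly_ring R {..<m}\<^esub> indexed_var i)) i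
        = up_ring.monom (UP R) (a i \<otimes> f i) 1"
      using i by (simp flip: U.monom_mult)
  qed (use f a in \<open>auto simp: Pi_def\<close>)
  also have "\<dots> = up_ring.monom (UP R) (\<Oplus>i\<in>{..<m}. a i \<otimes> f i) 1"
    using f a by (intro sum[symmetric]) (auto simp: Pi_def)
  finally show ?thesis .
qed

text \<open>The associativity \<open>(a v) f = a (v f)\<close> of matrix products, with a row
  \<open>a\<close>, a matrix \<open>v\<close> and a column \<open>f\<close>.\<close>

lemma finsum_combination_assoc:
  assumes a: "a \<in> {..<l} \<rightarrow> carrier R" and v: "\<And>j. j < l \<Longrightarrow> v j \<in> {..<m} \<rightarrow> carrier R"
    and f: "f \<in> {..<m} \<rightarrow> carrier R"
  shows "(\<Oplus>i\<in>{..<m::nat}. (\<Oplus>j\<in>{..<l::nat}. a j \<otimes> v j i) \<otimes> f i)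
    = (\<Oplus>j\<in>{..<l}. a j \<otimes> (\<Oplus>i\<in>{..<m}. v j i \<otimes> f i))"
proof -
  have vcl: "v j i \<in> carrier R" if "j < l" "i < m" for i j
    using v that by auto
  have cl: "a j \<otimes> (v j i \<otimes> f i) \<in> carrier R" if "j < l" "i < m" for i j
    using a vcl f that by (auto simp: Pi_def)
  have "(\<Oplus>i\<in>{..<m}. (\<Oplus>j\<in>{..<l}. a j \<otimes> v j i) \<otimes> f i)
      = (\<Oplus>i\<in>{..<m}. \<Oplus>j\<in>{..<l}. a j \<otimes> (v j i \<otimes> f i))"
  proof (intro finsum_cong')
    fix i assume "i \<in> {..<m}"
    then have i: "i < m" "f i \<in> carrier R" using f by auto
    have "(\<Oplus>j\<in>{..<l}. a j \<otimes> v j i) \<otimes> f i = (\<Oplus>j\<in>{..<l}. (a j \<otimes> v j i) \<otimes> f i)"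
      using i a vcl by (intro finsum_ldistr) auto
    also have "\<dots> = (\<Oplus>j\<in>{..<l}. a j \<otimes> (v j i \<otimes> f i))"
      using i a vcl by (intro finsum_cong') (auto simp: m_assoc Pi_def)
    finally show "(\<Oplus>j\<in>{..<l}. a j \<otimes> v j i) \<otimes> f i = (\<Oplus>j\<in>{..<l}. a j \<otimes> (v j i \<otimes> f i))" .
  qed (use cl in auto)
  also have "\<dots> = (\<Oplus>j\<in>{..<l}. \<Oplus>i\<in>{..<m}. a j \<otimes> (v j i \<otimes> f i))"
    using cl by (intro finsum_swap) auto
  also have "\<dots> = (\<Oplus>j\<in>{..<l}. a j \<otimes> (\<Oplus>i\<in>{..<m}. v j i \<otimes> f i))"
    using a vcl f by (intro finsum_cong' finsum_rdistr[symmetric]) (auto simp: Pi_def)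
  finally show ?thesis .
qed

section \<open>Linear substitutions between two systems of generators\<close>

definition linear_subst :: "nat \<Rightarrow> (nat \<Rightarrow> nat \<Rightarrow> 'a) \<Rightarrow> (nat multiset \<Rightarrow> 'a) \<Rightarrow> nat multiset \<Rightarrow> 'a"
  where "linear_subst m v
    = mpoly_eval R (mpoly_ring R {..<m}) indexed_const (\<lambda>j. linear_form m (v j))"

lemma linear_subst:
  assumes v: "\<And>j. j < l \<Longrightarrow> v j \<in> {..<m} \<rightarrow> carrier R"
  shows linear_subst_hom:
      "ring_hom_cring (mpoly_ring R {..<l}) (mpoly_ring R {..<m}) (linear_subst m v)"
    and linear_subst_const: "c \<in> carrier R \<Longrightarrow> linear_subst m v (indexed_const c) = indexed_const c"
    and linear_subst_var: "j < l \<Longrightarrow> linear_subst m v (indexed_var j) = linear_form m (v j)"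
proof -
  interpret C: ring_hom_cring R "mpoly_ring R {..<m}" indexed_const by (rule indexed_const_hom)
  have s: "(\<lambda>j. linear_form m (v j)) \<in> {..<l} \<rightarrow> carrier (mpoly_ring R {..<m})"
    using v by (auto intro: linear_form_closed)
  show "ring_hom_cring (mpoly_ring R {..<l}) (mpoly_ring R {..<m}) (linear_subst m v)"
    unfolding linear_subst_def by (rule C.mpoly_eval_hom[OF s])
  show "c \<in> carrier R \<Longrightarrow> linear_subst m v (indexed_const c) = indexed_const c"
    unfolding linear_subst_def by (rule C.mpoly_eval_const[OF s])
  show "j < l \<Longrightarrow> linear_subst m v (indexed_var j) = linear_form m (v j)"
    unfolding linear_subst_def using C.mpoly_eval_var[OF s] by simp
qed

text \<open>On rows of coefficients the substitution acts as multiplication by the matrix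
  \<open>v\<close> from the right.\<close>

lemma linear_subst_linear_form:
  assumes v: "\<And>j. j < l \<Longrightarrow> v j \<in> {..<m} \<rightarrow> carrier R" and a: "a \<in> {..<l} \<rightarrow> carrier R"
  shows "linear_subst m v (linear_form l a) = linear_form m (\<lambda>i. \<Oplus>j\<in>{..<l}. a j \<otimes> v j i)"
proof -
  let ?T = "mpoly_ring R {..<m}" and ?T' = "mpoly_ring R {..<l}"
  interpret S: ring_hom_cring ?T' ?T "linear_subst m v"
    by (rule linear_subst_hom[OF v])
  have cl: "indexed_const (a j) \<otimes>\<^bsub>?T'\<^esub> indexed_var j \<in> carrier ?T'" if "j < l" for j
    using that a by (intro S.R.m_closed indexed_const_closed indexed_var_closed) auto
  have av: "a j \<otimes> v j i \<in> carrier R" if "j < l" "i < m" for i j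
    using v[of j] a that by auto
  have "linear_subst m v (linear_form l a)
      = (\<Oplus>\<^bsub>?T\<^esub>j\<in>{..<l}. (linear_subst m v \<circ> (\<lambda>j. indexed_const (a j) \<otimes>\<^bsub>?T'\<^esub> indexed_var j)) j)"
    unfolding linear_form_def[of l] using cl by (intro S.hom_finsum) auto
  also have "\<dots> = (\<Oplus>\<^bsub>?T\<^esub>j\<in>{..<l}. linear_form m (\<lambda>i. a j \<otimes> v j i))"
  proof (intro S.S.finsum_cong')
    fix j assume "j \<in> {..<l}"
    then have j: "j < l" "a j \<in> carrier R"
      using a by auto
    then show "(linear_subst m v \<circ> (\<lambda>j. indexed_const (a j) \<otimes>\<^bsub>?T'\<^esub> indexed_var j)) j
        = linear_form m (\<lambda>i. a j \<otimes> v j i)"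
      by (simp add: indexed_const_closed indexed_var_closed linear_subst_const[OF v]
          linear_subst_var[OF v] const_mult_linear_form v)
  qed (use av in \<open>auto intro!: linear_form_closed\<close>)
  also have "\<dots> = linear_form m (\<lambda>i. \<Oplus>j\<in>{..<l}. a j \<otimes> v j i)"
    using av by (intro finsum_linear_form) auto
  finally show ?thesis .
qed

text \<open>Both sides are ring homomorphisms in \<open>P\<close>, so constants and variables
  suffice. The variable \<open>j\<close> goes to \<open>g j t\<close> under both, by the choice of
  \<open>v\<close>. In particular the substitution maps the Rees ideal of \<open>g\<close> into that
  of \<open>f\<close>.\<close>

lemma rees_hom_linear_subst:
  assumes v: "\<And>j. j < l \<Longrightarrow> v j \<in> {..<m} \<rightarrow> carrier R"
    and f: "f \<in> {..<m} \<rightarrow> carrier R" and g: "g \<in> {..<l} \<rightarrow> carrier R"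
    and gv: "\<And>j. j < l \<Longrightarrow> g j = (\<Oplus>i\<in>{..<m}. v j i \<otimes> f i)"
    and P: "P \<in> carrier (mpoly_ring R {..<l})"
  shows "rees_hom R f (linear_subst m v P) = rees_hom R g P"
proof -
  let ?T = "mpoly_ring R {..<m}" and ?T' = "mpoly_ring R {..<l}"
  interpret S: ring_hom_cring ?T' ?T "linear_subst m v" by (rule linear_subst_hom[OF v])
  interpret Hf: ring_hom_cring ?T "UP R" "rees_hom R f" by (rule rees_hom_hom[OF f])
  interpret Hg: ring_hom_cring ?T' "UP R" "rees_hom R g" by (rule rees_hom_hom[OF g])
  have "(rees_hom R f \<circ> linear_subst m v) P = rees_hom R g P"
    using P
  proof (rule mpoly_hom_eqI)
    show "rees_hom R f \<circ> linear_subst m v \<in> ring_hom ?T' (UP R)"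
      by (rule ring_hom_trans[OF S.homh Hf.homh])
  qed (use f v g gv in \<open>simp_all add: linear_subst_const[OF v] linear_subst_var[OF v]
      rees_hom_hom[OF f] rees_hom_hom[OF g] rees_hom_linear_form[OF f]\<close>)
  then show ?thesis by simp
qed

text \<open>The preimage of an ideal is an ideal, so only linear relations have to be followed. A
  relation \<open>a\<close> of \<open>g\<close> becomes the row \<open>a v\<close>, which is a
  relation of \<open>f\<close> because \<open>(a v) f = a (v f) = a g = 0\<close>.\<close>

lemma linear_subst_linear_ideal:
  assumes v: "\<And>j. j < l \<Longrightarrow> v j \<in> {..<m} \<rightarrow> carrier R"
    and f: "f \<in> {..<m} \<rightarrow> carrier R"
    and gv: "\<And>j. j < l \<Longrightarrow> g j = (\<Oplus>i\<in>{..<m}. v j i \<otimes> f i)"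
    and P: "P \<in> linear_ideal R l g"
  shows "linear_subst m v P \<in> linear_ideal R m f"
proof -
  let ?T = "mpoly_ring R {..<m}" and ?T' = "mpoly_ring R {..<l}"
  interpret S: ring_hom_cring ?T' ?T "linear_subst m v" by (rule linear_subst_hom[OF v])
  have "linear_ideal R l g \<subseteq> {P \<in> carrier ?T'. linear_subst m v P \<in> linear_ideal R m f}"
    unfolding linear_ideal_def[of R l g]
  proof (intro S.R.genideal_minimal S.ideal_vimage linear_ideal_ideal subsetI)
    fix P assume "P \<in> linear_relations R l g"
    then obtain a where P: "P = linear_form l a" and a: "a \<in> {..<l} \<rightarrow> carrier R"
      and rel: "(\<Oplus>j\<in>{..<l}. a j \<otimes> g j) = \<zero>"
      by (auto simp: linear_relations_eq)
    have av: "(\<Oplus>j\<in>{..<l}. a j \<otimes> v j i) \<in> carrier R" if "i < m" for i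
      using that a v by (intro finsum_closed) fastforce
    have "(\<Oplus>i\<in>{..<m}. (\<Oplus>j\<in>{..<l}. a j \<otimes> v j i) \<otimes> f i)
        = (\<Oplus>j\<in>{..<l}. a j \<otimes> (\<Oplus>i\<in>{..<m}. v j i \<otimes> f i))"
      by (rule finsum_combination_assoc[OF a v f])
    also have "\<dots> = (\<Oplus>j\<in>{..<l}. a j \<otimes> g j)"
      using a v f
      by (intro finsum_cong') (auto simp: gv Pi_def intro!: m_closed finsum_closed)
    finally have "linear_form m (\<lambda>i. \<Oplus>j\<in>{..<l}. a j \<otimes> v j i) \<in> linear_ideal R m f"
      using rel av by (intro linear_relation_in_linear_ideal) auto
    then show "P \<in> {P \<in> carrier ?T'. linear_subst m v P \<in> linear_ideal R m f}"
      using linear_form_closed[OF a] by (simp add: P linear_subst_linear_form[OF v a])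
  qed
  with P show ?thesis by blast
qed

lemma generators_as_combinations:
  assumes f: "f \<in> {..<m} \<rightarrow> carrier R" and g: "g \<in> {..<l} \<rightarrow> carrier R"
    and sub: "g ` {..<l} \<subseteq> genideal R (f ` {..<m::nat})"
  obtains v where "\<And>j. j < l \<Longrightarrow> v j \<in> {..<m} \<rightarrow> carrier R"
    "\<And>j. j < (l::nat) \<Longrightarrow> g j = (\<Oplus>i\<in>{..<m}. v j i \<otimes> f i)"
proof -
  have "\<exists>a. a \<in> {..<m} \<rightarrow> carrier R \<and> g j = (\<Oplus>i\<in>{..<m}. a i \<otimes> f i)" if "j < l" for j
  proof -
    have "g j \<in> genideal R (f ` {..<m})"
      using sub that by auto
    then obtain a where "a \<in> {..<m} \<rightarrow> carrier R" "g j = (\<Oplus>i\<in>{..<m}. a i \<otimes> f i)"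
      by (rule genideal_family_combination[OF f])
    then show ?thesis by blast
  qed
  then have "\<forall>j\<in>{..<l}. \<exists>a. a \<in> {..<m} \<rightarrow> carrier R \<and> g j = (\<Oplus>i\<in>{..<m}. a i \<otimes> f i)"
    by blast
  from bchoice[OF this] obtain v where
    "\<forall>j\<in>{..<l}. v j \<in> {..<m} \<rightarrow> carrier R \<and> g j = (\<Oplus>i\<in>{..<m}. v j i \<otimes> f i)" ..
  then show thesis
    by (intro that[of v]) auto
qed

text \<open>The two systems of generators give substitutions \<open>\<sigma>\<close> and \<open>\<tau>\<close> between the two
  polynomial rings; they preserve both kinds of ideals, and \<open>\<tau> \<circ> \<sigma>\<close> is the identity
  modulo linear relations.\<close>

lemma conductor_mono_generators:
  assumes f: "f \<in> {..<m} \<rightarrow> carrier R" and g: "g \<in> {..<l} \<rightarrow> carrier R"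
    and eq: "genideal R (f ` {..<m}) = genideal R (g ` {..<l})"
  shows "conductor R l g \<subseteq> conductor R m f"
proof
  let ?Tf = "mpoly_ring R {..<m}" and ?Tg = "mpoly_ring R {..<l}"
  have "f ` {..<m} \<subseteq> genideal R (g ` {..<l})"
    using genideal_self[of "f ` {..<m}"] f by (auto simp flip: eq)
  then obtain u where u: "\<And>i. i < m \<Longrightarrow> u i \<in> {..<l} \<rightarrow> carrier R"
    "\<And>i. i < m \<Longrightarrow> f i = (\<Oplus>j\<in>{..<l}. u i j \<otimes> g j)"
    using generators_as_combinations[OF g f] by blast
  have "g ` {..<l} \<subseteq> genideal R (f ` {..<m})"
    using genideal_self[of "g ` {..<l}"] g by (auto simp: eq)
  then obtain v where v: "\<And>j. j < l \<Longrightarrow> v j \<in> {..<m} \<rightarrow> carrier R"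
    "\<And>j. j < l \<Longrightarrow> g j = (\<Oplus>i\<in>{..<m}. v j i \<otimes> f i)"
    using generators_as_combinations[OF f g] by blast
  define \<sigma> where "\<sigma> = linear_subst l u"
  define \<tau> where "\<tau> = linear_subst m v"
  interpret S: ring_hom_cring ?Tf ?Tg \<sigma>
    unfolding \<sigma>_def by (rule linear_subst_hom[OF u(1)])
  interpret T: ring_hom_cring ?Tg ?Tf \<tau>
    unfolding \<tau>_def by (rule linear_subst_hom[OF v(1)])
  interpret C: ring_hom_cring R ?Tf indexed_const by (rule indexed_const_hom)
  interpret L: ideal "linear_ideal R m f" ?Tf by (rule linear_ideal_ideal)
  have minus_in_L: "x \<ominus>\<^bsub>?Tf\<^esub> y \<in> linear_ideal R m f"
    if "x \<in> linear_ideal R m f" "y \<in> linear_ideal R m f" for x y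
    using that by (simp add: a_minus_def L.a_closed L.a_inv_closed)
  have TS: "\<tau> (\<sigma> P) \<ominus>\<^bsub>?Tf\<^esub> P \<in> linear_ideal R m f" if "P \<in> carrier ?Tf" for P
    using that
  proof (induction rule: mpoly_induct)
    case (const c)
    then have "\<tau> (\<sigma> (indexed_const c)) = indexed_const c"
      by (simp add: \<sigma>_def \<tau>_def linear_subst_const[OF u(1)] linear_subst_const[OF v(1)])
    then show ?case
      using const by (simp add: a_minus_def S.R.r_neg L.zero_closed)
  next
    case (add P Q)
    have "\<tau> (\<sigma> (P \<oplus>\<^bsub>?Tf\<^esub> Q)) \<ominus>\<^bsub>?Tf\<^esub> (P \<oplus>\<^bsub>?Tf\<^esub> Q)
        = (\<tau> (\<sigma> P) \<ominus>\<^bsub>?Tf\<^esub> P) \<oplus>\<^bsub>?Tf\<^esub> (\<tau> (\<sigma> Q) \<ominus>\<^bsub>?Tf\<^esub> Q)"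
      using add by (simp add: a_minus_def S.R.minus_add S.R.a_ac)
    then show ?case
      using add by (simp add: L.a_closed)
  next
    case (mult P i)
    \<comment> \<open>\<open>?w\<close> is row \<open>i\<close> of the matrix product
      \<open>u v\<close>, and \<open>?e\<close> is minus the unit row \<open>i\<close>. Since
      \<open>u (v f) = u g = f\<close>, the row \<open>?w + ?e\<close> is a relation of
      \<open>f\<close>; its form is the difference between
      \<open>\<tau> (\<sigma> (indexed_var i))\<close> and \<open>indexed_var i\<close>.\<close>
    let ?w = "\<lambda>k. \<Oplus>j\<in>{..<l}. u i j \<otimes> v j k" and ?e = "\<lambda>k. if i = k then \<ominus> \<one> else \<zero>"
    have i: "i < m" using mult by simp
    have w: "?w \<in> {..<m} \<rightarrow> carrier R"
      using u(1)[OF i] v(1) by (fastforce intro!: finsum_closed)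
    have e: "?e \<in> {..<m} \<rightarrow> carrier R" by simp
    have var: "indexed_var i \<in> carrier ?Tf"
      using mult by (simp add: indexed_var_closed)
    have "(\<Oplus>k\<in>{..<m}. (?w k \<oplus> ?e k) \<otimes> f k) = (\<Oplus>k\<in>{..<m}. ?w k \<otimes> f k \<oplus> ?e k \<otimes> f k)"
      using w e f by (intro finsum_cong') (auto simp: l_distr Pi_def)
    also have "\<dots> = (\<Oplus>k\<in>{..<m}. ?w k \<otimes> f k) \<oplus> (\<Oplus>k\<in>{..<m}. ?e k \<otimes> f k)"
      using w e f by (intro finsum_addf) (auto simp: Pi_def)
    also have "(\<Oplus>k\<in>{..<m}. ?e k \<otimes> f k) = (\<Oplus>k\<in>{..<m}. if i = k then \<ominus> f k else \<zero>)"
      using f by (intro finsum_cong') (auto simp: l_minus Pi_def)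
    also have "\<dots> = \<ominus> f i"
      using f i by (intro finsum_singleton) (auto simp: Pi_def)
    also have "(\<Oplus>k\<in>{..<m}. ?w k \<otimes> f k) = (\<Oplus>j\<in>{..<l}. u i j \<otimes> (\<Oplus>k\<in>{..<m}. v j k \<otimes> f k))"
      by (rule finsum_combination_assoc[OF u(1)[OF i] v(1) f])
    also have "\<dots> = (\<Oplus>j\<in>{..<l}. u i j \<otimes> g j)"
      using u(1)[OF i] g by (intro finsum_cong') (auto simp: v(2)[symmetric] Pi_def)
    also have "\<dots> = f i"
      by (rule u(2)[OF i, symmetric])
    finally have "(\<Oplus>k\<in>{..<m}. (?w k \<oplus> ?e k) \<otimes> f k) = \<zero>"
      using f i by (auto simp: r_neg Pi_def)
    then have "linear_form m (\<lambda>k. ?w k \<oplus> ?e k) \<in> linear_ideal R m f"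
      using w e by (intro linear_relation_in_linear_ideal) auto
    moreover have "linear_form m ?e = \<ominus>\<^bsub>?Tf\<^esub> indexed_var i"
    proof -
      have "linear_form m ?e
        = indexed_const (\<ominus> \<one>) \<otimes>\<^bsub>?Tf\<^esub> linear_form m (\<lambda>k. if i = k then \<one> else \<zero>)"
      proof (subst const_mult_linear_form)
        have "(\<lambda>k. \<ominus> \<one> \<otimes> (if i = k then \<one> else \<zero>)) = ?e" by auto
        then show "linear_form m ?e = linear_form m (\<lambda>k. \<ominus> \<one> \<otimes> (if i = k then \<one> else \<zero>))"
          by (rule arg_cong[OF sym])
      qed auto
      then show ?thesis
        using var by (simp add: linear_form_var[OF i] S.R.l_minus)
    qed
    moreover have "\<tau> (\<sigma> (indexed_var i)) = linear_form m ?w"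
      using i u(1)[OF i]
      by (simp add: \<sigma>_def \<tau>_def linear_subst_var[OF u(1)] linear_subst_linear_form[OF v(1)])
    ultimately have L: "\<tau> (\<sigma> (indexed_var i)) \<ominus>\<^bsub>?Tf\<^esub> indexed_var i \<in> linear_ideal R m f"
      by (simp add: a_minus_def linear_form_add[OF w e, symmetric])
    have "\<tau> (\<sigma> (P \<otimes>\<^bsub>?Tf\<^esub> indexed_var i)) \<ominus>\<^bsub>?Tf\<^esub> P \<otimes>\<^bsub>?Tf\<^esub> indexed_var i
      = \<tau> (\<sigma> P) \<otimes>\<^bsub>?Tf\<^esub> (\<tau> (\<sigma> (indexed_var i)) \<ominus>\<^bsub>?Tf\<^esub> indexed_var i)
        \<oplus>\<^bsub>?Tf\<^esub> (\<tau> (\<sigma> P) \<ominus>\<^bsub>?Tf\<^esub> P) \<otimes>\<^bsub>?Tf\<^esub> indexed_var i"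
    proof -
      have "\<tau> (\<sigma> P) \<in> carrier ?Tf" "\<tau> (\<sigma> (indexed_var i)) \<in> carrier ?Tf"
        using mult var by auto
      then show ?thesis
        using mult(1) var by (simp add: S.R.mult_diff_split)
    qed
    then show ?case
      using L mult var by (simp add: L.a_closed L.I_l_closed L.I_r_closed)
  qed
  fix r assume r: "r \<in> conductor R l g"
  then have rR: "r \<in> carrier R" by (simp add: conductor_def)
  \<comment> \<open>As \<open>\<sigma> P\<close> lies in the Rees ideal of \<open>g\<close>, the
    product of \<open>r\<close> with it lies in the linear ideal of \<open>g\<close>. The map
    \<open>\<tau>\<close> fixes the constant \<open>r\<close> and carries this product into the
    linear ideal of \<open>f\<close>, where \<open>TS\<close> allows
    \<open>\<tau> (\<sigma> P)\<close> to be replaced by \<open>P\<close>.\<close>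
  have "indexed_const r \<otimes>\<^bsub>?Tf\<^esub> P \<in> linear_ideal R m f" if "P \<in> rees_ideal R m f" for P
  proof -
    from that have P: "P \<in> carrier ?Tf" "rees_hom R f P = \<zero>\<^bsub>UP R\<^esub>"
      by (auto simp: rees_ideal_eq)
    then have "\<sigma> P \<in> rees_ideal R l g"
      using rees_hom_linear_subst[OF u(1) g f u(2) P(1)] by (auto simp: rees_ideal_eq \<sigma>_def[symmetric])
    with r have const_P: "indexed_const r \<otimes>\<^bsub>?Tg\<^esub> \<sigma> P \<in> linear_ideal R l g"
      by (simp add: conductor_def)
    have \<tau>_const: "\<tau> (indexed_const r) = indexed_const r"
      unfolding \<tau>_def by (rule linear_subst_const[OF v(1) rR])
    from linear_subst_linear_ideal[OF v(1) f v(2) const_P]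
    have "\<tau> (indexed_const r \<otimes>\<^bsub>?Tg\<^esub> \<sigma> P) \<in> linear_ideal R m f"
      by (simp add: \<tau>_def)
    then have 1: "indexed_const r \<otimes>\<^bsub>?Tf\<^esub> \<tau> (\<sigma> P) \<in> linear_ideal R m f"
      using P rR \<tau>_const by (simp add: indexed_const_closed)
    have 2: "indexed_const r \<otimes>\<^bsub>?Tf\<^esub> (\<tau> (\<sigma> P) \<ominus>\<^bsub>?Tf\<^esub> P) \<in> linear_ideal R m f"
      by (rule L.I_l_closed[OF TS[OF P(1)] C.hom_closed[OF rR]])
    have "indexed_const r \<otimes>\<^bsub>?Tf\<^esub> P
      = indexed_const r \<otimes>\<^bsub>?Tf\<^esub> \<tau> (\<sigma> P) \<ominus>\<^bsub>?Tf\<^esub> indexed_const r \<otimes>\<^bsub>?Tf\<^esub> (\<tau> (\<sigma> P) \<ominus>\<^bsub>?Tf\<^esub> P)"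
      using P rR by (intro S.R.mult_minus_mult_diff) auto
    with minus_in_L[OF 1 2] show ?thesis by simp
  qed
  with rR show "r \<in> conductor R m f"
    by (simp add: conductor_def)
qed

corollary conductor_cong_generators:
  assumes "f \<in> {..<m} \<rightarrow> carrier R" "g \<in> {..<l} \<rightarrow> carrier R"
    and "genideal R (f ` {..<m}) = genideal R (g ` {..<l})"
  shows "conductor R m f = conductor R l g"
  using assms by (intro equalityI conductor_mono_generators) auto

end

section \<open>Gradings\<close>

lemma (in ideal) finsum_in_ideal:
  "(\<And>i. i \<in> A \<Longrightarrow> f i \<in> I) \<Longrightarrow> (\<Oplus>i\<in>A. f i) \<in> I"
proof (induction A rule: infinite_finite_induct)
  case (insert x A)
  then have "f \<in> A \<rightarrow> carrier R" "f x \<in> carrier R"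
    using Icarr by auto
  then show ?case
    using insert by (simp add: a_closed)
qed auto

lemma (in cring) mpoly_finsum_coeff:
  assumes "\<And>i. i \<in> A \<Longrightarrow> F i \<in> carrier (mpoly_ring R V)"
  shows "(\<Oplus>\<^bsub>mpoly_ring R V\<^esub>i\<in>A. F i) n = (\<Oplus>i\<in>A. F i n)"
  using assms
proof (induction A rule: infinite_finite_induct)
  case (insert x A)
  interpret T: cring "mpoly_ring R V" by (rule cring_mpoly_ring)
  have "F \<in> A \<rightarrow> carrier (mpoly_ring R V)" "(\<lambda>i. F i n) \<in> A \<rightarrow> carrier R"
    "F x \<in> carrier (mpoly_ring R V)" "F x n \<in> carrier R"
    using insert.prems mpoly_coeff_closed[of "F _" V n] by auto
  then show ?case
    using insert by (simp add: mpoly_ring_simps indexed_padd_def)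
next
  case (infinite A)
  interpret T: cring "mpoly_ring R V" by (rule cring_mpoly_ring)
  show ?case
    using infinite by (simp add: T.finsum_infinite finsum_infinite) (simp add: mpoly_ring_simps indexed_const_def)
next
  case empty
  interpret T: cring "mpoly_ring R V" by (rule cring_mpoly_ring)
  show ?case
    by simp (simp add: mpoly_ring_simps indexed_const_def)
qed

text \<open>A grading is given by its projections. The degrees only form a cancellative monoid, so
  that monomials, represented as multisets, can serve as degrees.\<close>

locale graded_cring = cring R for R (structure) +
  fixes \<pi> :: "'g::cancel_comm_monoid_add \<Rightarrow> 'a \<Rightarrow> 'a"
  assumes comp_closed [simp, intro]: "x \<in> carrier R \<Longrightarrow> \<pi> i x \<in> carrier R"
    and comp_add: "x \<in> carrier R \<Longrightarrow> y \<in> carrier R \<Longrightarrow> \<pi> i (x \<oplus> y) = \<pi> i x \<oplus> \<pi> i y"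
    and comp_comp: "x \<in> carrier R \<Longrightarrow> \<pi> i (\<pi> j x) = (if i = j then \<pi> i x else \<zero>)"
    and comp_finite: "x \<in> carrier R \<Longrightarrow> finite {i. \<pi> i x \<noteq> \<zero>}"
    and comp_sum: "x \<in> carrier R \<Longrightarrow> (\<Oplus>i\<in>{i. \<pi> i x \<noteq> \<zero>}. \<pi> i x) = x"
    and comp_mult: "x \<in> carrier R \<Longrightarrow> y \<in> carrier R \<Longrightarrow> \<pi> i x = x \<Longrightarrow> \<pi> j y = y \<Longrightarrow>
      \<pi> (i + j) (x \<otimes> y) = x \<otimes> y"
begin

lemma comp_zero [simp]: "\<pi> i \<zero> = \<zero>"
proof -
  have "\<pi> i \<zero> \<oplus> \<pi> i \<zero> = \<pi> i \<zero> \<oplus> \<zero>"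
    using comp_add[of \<zero> \<zero> i] by simp
  then show ?thesis
    by (simp del: r_zero)
qed

lemma comp_finsum:
  assumes "\<And>j. j \<in> A \<Longrightarrow> f j \<in> carrier R"
  shows "\<pi> i (\<Oplus>j\<in>A. f j) = (\<Oplus>j\<in>A. \<pi> i (f j))"
  using assms by (induction A rule: infinite_finite_induct) (auto simp: comp_add Pi_def)

lemma comp_sum_superset:
  assumes "x \<in> carrier R" "finite F" "\<And>i. \<pi> i x \<noteq> \<zero> \<Longrightarrow> i \<in> F"
  shows "(\<Oplus>i\<in>F. \<pi> i x) = x"
proof -
  have "(\<Oplus>i\<in>{i. \<pi> i x \<noteq> \<zero>}. \<pi> i x) = (\<Oplus>i\<in>F. \<pi> i x)"
    using assms by (intro add.finprod_mono_neutral_cong_left) auto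
  then show ?thesis
    using comp_sum[OF assms(1)] by simp
qed

text \<open>The component of degree \<open>e - d\<close>, or zero if there is no such degree.\<close>

definition shift_comp :: "'g \<Rightarrow> 'g \<Rightarrow> 'a \<Rightarrow> 'a"
  where "shift_comp d e x = (if \<exists>i. e = i + d then \<pi> (THE i. e = i + d) x else \<zero>)"

text \<open>Cancellation makes the degree selected by \<open>THE\<close> unique.\<close>

lemma shift_comp_add_degree [simp]: "shift_comp d (i + d) x = \<pi> i x"
  unfolding shift_comp_def by auto

lemma shift_comp_no_degree: "\<nexists>i. e = i + d \<Longrightarrow> shift_comp d e x = \<zero>"
  unfolding shift_comp_def by auto

lemma shift_comp_cases:
  obtains i where "e = i + d" "\<And>x. shift_comp d e x = \<pi> i x"
  | "\<nexists>i. e = i + d" "\<And>x. shift_comp d e x = \<zero>"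
  using shift_comp_add_degree shift_comp_no_degree by metis

lemma shift_comp_0 [simp]: "shift_comp 0 e x = \<pi> e x"
  using shift_comp_add_degree[of 0 e x] by simp

lemma shift_comp_closed [simp, intro]: "x \<in> carrier R \<Longrightarrow> shift_comp d e x \<in> carrier R"
  by (rule shift_comp_cases[of e d]) auto

lemma shift_comp_zero [simp]: "shift_comp d e \<zero> = \<zero>"
  by (rule shift_comp_cases[of e d]) auto

lemma shift_comp_add:
  "x \<in> carrier R \<Longrightarrow> y \<in> carrier R \<Longrightarrow> shift_comp d e (x \<oplus> y) = shift_comp d e x \<oplus> shift_comp d e y"
  by (rule shift_comp_cases[of e d]) (auto simp: comp_add)

lemma shift_comp_finsum:
  assumes "\<And>j. j \<in> A \<Longrightarrow> f j \<in> carrier R"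
  shows "shift_comp d e (\<Oplus>j\<in>A. f j) = (\<Oplus>j\<in>A. shift_comp d e (f j))"
  using assms by (rule_tac shift_comp_cases[of e d]) (auto simp: comp_finsum)

lemma shift_comp_comp:
  assumes "x \<in> carrier R"
  shows "shift_comp d e (shift_comp d e' x) = (if e = e' then shift_comp d e x else \<zero>)"
proof (rule shift_comp_cases[of e d])
  fix i assume i: "e = i + d"
  show ?thesis
    by (rule shift_comp_cases[of e' d]) (auto simp: i comp_comp[OF assms])
next
  assume "\<And>x. shift_comp d e x = \<zero>"
  then show ?thesis by (cases "e = e'") auto
qed

text \<open>If both differences exist, they add up to the difference for \<open>e + e'\<close> and
  \<open>d + d'\<close>, and \<open>comp_mult\<close> applies. If one is missing, the corresponding
  factor equals its own zero component, hence is zero.\<close>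

lemma shift_comp_mult:
  assumes "x \<in> carrier R" "y \<in> carrier R" "shift_comp d e x = x" "shift_comp d' e' y = y"
  shows "shift_comp (d + d') (e + e') (x \<otimes> y) = x \<otimes> y"
proof (rule shift_comp_cases[of e d])
  fix i assume i: "e = i + d" "\<And>x. shift_comp d e x = \<pi> i x"
  show ?thesis
  proof (rule shift_comp_cases[of e' d'])
    fix j assume j: "e' = j + d'" "\<And>x. shift_comp d' e' x = \<pi> j x"
    have "e + e' = (i + j) + (d + d')"
      by (simp add: i(1) j(1) ac_simps)
    then show ?thesis
      using comp_mult[of x y i j] assms i j by simp
  next
    assume "\<And>x. shift_comp d' e' x = \<zero>"
    then have "y = \<zero>" using assms by simp
    then show ?thesis using assms by simp
  qed
next
  assume "\<And>x. shift_comp d e x = \<zero>"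
  then have "x = \<zero>" using assms by simp
  then show ?thesis using assms by simp
qed

text \<open>The degrees \<open>i\<close> with nonzero component are only moved to
  \<open>i + d\<close>, and cancellation makes this move injective.\<close>

lemma shift_comp_sum:
  assumes x: "x \<in> carrier R" and E: "finite E" "\<And>e. shift_comp d e x \<noteq> \<zero> \<Longrightarrow> e \<in> E"
  shows "(\<Oplus>e\<in>E. shift_comp d e x) = x"
proof -
  let ?F = "{i. \<pi> i x \<noteq> \<zero>}"
  have "(\<Oplus>e\<in>(\<lambda>i. i + d) ` ?F. shift_comp d e x) = (\<Oplus>e\<in>E. shift_comp d e x)"
  proof (intro add.finprod_mono_neutral_cong_left)
    show "(\<lambda>i. i + d) ` ?F \<subseteq> E"
      using E(2) by force
    show "shift_comp d e x = \<zero>" if "e \<in> E - (\<lambda>i. i + d) ` ?F" for e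
      by (rule shift_comp_cases[of e d]) (use that in auto)
  qed (use x E in auto)
  also have "(\<Oplus>e\<in>(\<lambda>i. i + d) ` ?F. shift_comp d e x) = (\<Oplus>i\<in>?F. shift_comp d (i + d) x)"
    using x by (intro finsum_reindex) (auto simp: inj_on_def)
  also have "\<dots> = x"
    using comp_sum[OF x] by simp
  finally show ?thesis ..
qed

text \<open>The place where cancellation of degrees acts: the products of \<open>h\<close> with the
  components of \<open>x\<close> have the degrees \<open>j + d\<close>, which are pairwise distinct.
  Hence at most one component of \<open>x\<close> contributes in degree \<open>e\<close>, and none
  if \<open>e\<close> is not of this form.\<close>

lemma comp_mult_homogeneous:
  assumes x: "x \<in> carrier R" and h: "h \<in> carrier R" "\<pi> d h = h"
  shows "\<pi> e (x \<otimes> h) = shift_comp d e x \<otimes> h"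
proof -
  have comp_term: "\<pi> e (\<pi> j x \<otimes> h) = (if e = j + d then \<pi> j x \<otimes> h else \<zero>)" for j
  proof -
    have "\<pi> (j + d) (\<pi> j x \<otimes> h) = \<pi> j x \<otimes> h"
      using x h by (intro comp_mult) (auto simp: comp_comp)
    then show ?thesis
      using comp_comp[of "\<pi> j x \<otimes> h" e "j + d"] x h by auto
  qed
  have sum: "\<pi> e (x \<otimes> h) = (\<Oplus>j\<in>F. if e = j + d then \<pi> j x \<otimes> h else \<zero>)"
    if F: "finite F" "{i. \<pi> i x \<noteq> \<zero>} \<subseteq> F" for F
  proof -
    have "x \<otimes> h = (\<Oplus>j\<in>F. \<pi> j x) \<otimes> h"
      using F x by (subst comp_sum_superset) auto
    also have "\<dots> = (\<Oplus>j\<in>F. \<pi> j x \<otimes> h)"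
      using F x h by (intro finsum_ldistr) auto
    finally show ?thesis
      using x h by (simp add: comp_finsum comp_term)
  qed
  show ?thesis
  proof (rule shift_comp_cases[of e d])
    fix i assume i: "e = i + d" "\<And>x. shift_comp d e x = \<pi> i x"
    \<comment> \<open>The index \<open>i\<close> is inserted because the component of
      \<open>x\<close> in this degree may be zero, while the one surviving summand has to be among
      the indices.\<close>
    let ?F = "insert i {i. \<pi> i x \<noteq> \<zero>}"
    have "\<pi> e (x \<otimes> h) = (\<Oplus>j\<in>?F. if e = j + d then \<pi> j x \<otimes> h else \<zero>)"
      by (rule sum) (use comp_finite[OF x] in auto)
    also have "\<dots> = (\<Oplus>j\<in>?F. if i = j then \<pi> j x \<otimes> h else \<zero>)"
      using x h by (intro finsum_cong') (auto simp: i)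
    also have "\<dots> = \<pi> i x \<otimes> h"
      using comp_finite[OF x] x h by (intro finsum_singleton) auto
    finally show ?thesis
      by (simp add: i)
  next
    assume e: "\<nexists>i. e = i + d" "\<And>x. shift_comp d e x = \<zero>"
    then have "\<pi> e (x \<otimes> h) = (\<Oplus>j\<in>{i. \<pi> i x \<noteq> \<zero>}. \<zero>)"
      by (subst sum[of "{i. \<pi> i x \<noteq> \<zero>}"]) (use comp_finite[OF x] in auto)
    then show ?thesis
      using h by (simp add: e)
  qed
qed

text \<open>The axioms of the locale do not mention the unit. Taking the component of degree
  \<open>d\<close> in \<open>1 h = h\<close>, for \<open>h\<close> homogeneous of degree
  \<open>d\<close>, shows that the degree zero part of the unit fixes \<open>h\<close>. It therefore
  fixes all components of the unit, and so their sum. This gives the variables of \<open>T\<close>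
  their prescribed degrees.\<close>

lemma comp_0_one: "\<pi> 0 \<one> = \<one>"
proof -
  have hom: "\<pi> 0 \<one> \<otimes> h = h" if "h \<in> carrier R" "\<pi> d h = h" for d h
    using comp_mult_homogeneous[of \<one> h d d] shift_comp_add_degree[of d 0 \<one>] that by simp
  have "\<pi> 0 \<one> = \<pi> 0 \<one> \<otimes> (\<Oplus>i\<in>{i. \<pi> i \<one> \<noteq> \<zero>}. \<pi> i \<one>)"
    by (simp add: comp_sum)
  also have "\<dots> = (\<Oplus>i\<in>{i. \<pi> i \<one> \<noteq> \<zero>}. \<pi> 0 \<one> \<otimes> \<pi> i \<one>)"
    using comp_finite[of \<one>] by (intro finsum_rdistr) auto
  also have "\<dots> = (\<Oplus>i\<in>{i. \<pi> i \<one> \<noteq> \<zero>}. \<pi> i \<one>)"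
    by (intro finsum_cong') (auto simp: comp_comp intro!: hom)
  also have "\<dots> = \<one>"
    by (simp add: comp_sum)
  finally show ?thesis .
qed

text \<open>The elements all of whose components lie in the ideal form an ideal themselves. For a
  multiple \<open>r x\<close> it is \<open>x\<close> that is split, not \<open>r\<close>: each
  component of \<open>r x\<close> is then a combination of components of \<open>x\<close>, with
  components of \<open>r\<close> as coefficients.\<close>

lemma genideal_comp_closed:
  assumes S: "S \<subseteq> carrier R" and comp: "\<And>s i. s \<in> S \<Longrightarrow> \<pi> i s \<in> genideal R S"
    and x: "x \<in> genideal R S"
  shows "\<pi> i x \<in> genideal R S"
proof -
  interpret I: ideal "genideal R S" R
    by (rule genideal_ideal[OF S])
  let ?M = "{x \<in> carrier R. \<forall>i. \<pi> i x \<in> genideal R S}"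
  have "ideal ?M R"
  proof (rule ideal_if_closed)
    fix r x assume r: "r \<in> carrier R" and "x \<in> ?M"
    then have x: "x \<in> carrier R" "\<And>i. \<pi> i x \<in> genideal R S" by auto
    let ?F = "{i. \<pi> i x \<noteq> \<zero>}"
    have "r \<otimes> x = r \<otimes> (\<Oplus>j\<in>?F. \<pi> j x)"
      using x by (simp add: comp_sum)
    also have "\<dots> = (\<Oplus>j\<in>?F. r \<otimes> \<pi> j x)"
      using comp_finite r x by (intro finsum_rdistr) auto
    finally have "\<pi> k (r \<otimes> x) = (\<Oplus>j\<in>?F. \<pi> k (r \<otimes> \<pi> j x))" for k
      using r x by (simp add: comp_finsum)
    moreover have "\<pi> k (r \<otimes> \<pi> j x) = shift_comp j k r \<otimes> \<pi> j x" for j k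
      using r x by (intro comp_mult_homogeneous) (auto simp: comp_comp)
    ultimately show "r \<otimes> x \<in> ?M"
      using r x by (auto intro!: I.finsum_in_ideal I.I_l_closed)
  qed (auto simp: comp_add I.a_closed)
  moreover have "S \<subseteq> ?M"
    using S comp by auto
  ultimately show ?thesis
    using genideal_minimal x by blast
qed

text \<open>Leads back from closure under components to generation by homogeneous elements, the form
  in which \<open>graded_ideal\<close> is defined and from which monomial generators are
  obtained.\<close>

lemma genideal_of_components:
  assumes "ideal I R" and comp: "\<And>x i. x \<in> I \<Longrightarrow> \<pi> i x \<in> I"
  shows "genideal R {\<pi> i x | i x. x \<in> I} = I"
proof -
  interpret I: ideal I R by fact
  let ?S = "{\<pi> i x | i x. x \<in> I}"
  have S: "?S \<subseteq> carrier R"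
    using I.Icarr by auto
  interpret G: ideal "genideal R ?S" R
    by (rule genideal_ideal[OF S])
  have "x \<in> genideal R ?S" if "x \<in> I" for x
  proof -
    have "(\<Oplus>i\<in>{i. \<pi> i x \<noteq> \<zero>}. \<pi> i x) \<in> genideal R ?S"
      using genideal_self[OF S] that by (intro G.finsum_in_ideal) auto
    then show ?thesis
      using that by (simp add: comp_sum I.Icarr)
  qed
  moreover have "genideal R ?S \<subseteq> I"
    using comp by (intro genideal_minimal assms(1)) auto
  ultimately show ?thesis by auto
qed

section \<open>The grading of \<open>T\<close> induced by degrees of the variables\<close>

definition mpoly_comp :: "('v \<Rightarrow> 'g) \<Rightarrow> 'g \<Rightarrow> ('v multiset \<Rightarrow> 'a) \<Rightarrow> 'v multiset \<Rightarrow> 'a"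
  where "mpoly_comp d e P = (\<lambda>n. shift_comp (\<Sum>j\<in>#n. d j) e (P n))"

lemma mpoly_comp_closed:
  assumes "P \<in> carrier (mpoly_ring R V)"
  shows "mpoly_comp d e P \<in> carrier (mpoly_ring R V)"
proof -
  have "mpoly_comp d e P n \<noteq> \<zero> \<Longrightarrow> P n \<noteq> \<zero>" for n
    by (auto simp: mpoly_comp_def)
  moreover from this have "finite {n. mpoly_comp d e P n \<noteq> \<zero>}"
    using assms by (auto simp: mpoly_ring_simps mem_indexed_pset_iff
      intro: rev_finite_subset[of "{n. P n \<noteq> \<zero>}"])
  moreover have "mpoly_comp d e P n \<in> carrier R" for n
    using mpoly_coeff_closed[OF assms] by (auto simp: mpoly_comp_def)
  ultimately show ?thesis
    using assms by (auto simp: mpoly_ring_simps mem_indexed_pset_iff)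
qed

text \<open>The degree of a term is that of its coefficient plus the weight of its monomial, so a
  homogeneous part of degree \<open>e\<close> is cut out coefficientwise at \<open>e\<close> minus
  the weight. In the convolution the weights of \<open>a\<close> and \<open>n - a\<close> add up to
  that of \<open>n\<close>, which reduces the product rule to
  \<open>shift_comp_mult\<close>.\<close>

lemma mpoly_graded_cring: "graded_cring (mpoly_ring R V) (mpoly_comp d)"
proof (intro graded_cring.intro graded_cring_axioms.intro)
  let ?T = "mpoly_ring R V"
  interpret T: cring ?T by (rule cring_mpoly_ring)
  show "cring ?T" by (rule cring_mpoly_ring)
  fix P assume P: "P \<in> carrier ?T"
  note [simp] = mpoly_coeff_closed[OF P]
  show "mpoly_comp d e P \<in> carrier ?T" for e
    by (rule mpoly_comp_closed[OF P])
  show "mpoly_comp d e (mpoly_comp d e' P) = (if e = e' then mpoly_comp d e P else \<zero>\<^bsub>?T\<^esub>)" for e e'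
    by (auto simp: mpoly_comp_def shift_comp_comp mpoly_ring_simps indexed_const_def)
  let ?E = "{e. mpoly_comp d e P \<noteq> \<zero>\<^bsub>?T\<^esub>}"
  \<comment> \<open>Finitely many coefficients with finitely many components each leave only
    finitely many degrees.\<close>
  have sub: "?E \<subseteq> (\<Union>n\<in>{n. P n \<noteq> \<zero>}. (\<lambda>i. i + (\<Sum>j\<in>#n. d j)) ` {i. \<pi> i (P n) \<noteq> \<zero>})"
  proof
    fix e assume "e \<in> ?E"
    then obtain n where n: "shift_comp (\<Sum>j\<in>#n. d j) e (P n) \<noteq> \<zero>"
      by (auto simp: mpoly_comp_def mpoly_ring_simps indexed_const_def fun_eq_iff)
    then obtain i where "e = i + (\<Sum>j\<in>#n. d j)" "\<pi> i (P n) \<noteq> \<zero>"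
      using shift_comp_cases[of e "\<Sum>j\<in>#n. d j"] by metis
    then show "e \<in> (\<Union>n\<in>{n. P n \<noteq> \<zero>}. (\<lambda>i. i + (\<Sum>j\<in>#n. d j)) ` {i. \<pi> i (P n) \<noteq> \<zero>})"
      by (intro UN_I[of n]) auto
  qed
  have "finite {n. P n \<noteq> \<zero>}"
    using P by (simp add: mpoly_ring_simps mem_indexed_pset_iff)
  then show fin: "finite ?E"
    by (intro finite_subset[OF sub]) (auto simp: comp_finite)
  show "(\<Oplus>\<^bsub>?T\<^esub>e\<in>?E. mpoly_comp d e P) = P"
  proof
    fix n
    have "(\<Oplus>\<^bsub>?T\<^esub>e\<in>?E. mpoly_comp d e P) n = (\<Oplus>e\<in>?E. mpoly_comp d e P n)"
      by (rule mpoly_finsum_coeff) (rule mpoly_comp_closed[OF P])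
    also have "\<dots> = P n"
      unfolding mpoly_comp_def
      by (rule shift_comp_sum) (use fin in \<open>auto simp: mpoly_comp_def mpoly_ring_simps indexed_const_def fun_eq_iff\<close>)
    finally show "(\<Oplus>\<^bsub>?T\<^esub>e\<in>?E. mpoly_comp d e P) n = P n" .
  qed
  fix Q assume Q: "Q \<in> carrier ?T"
  note [simp] = mpoly_coeff_closed[OF Q]
  show "mpoly_comp d e (P \<oplus>\<^bsub>?T\<^esub> Q) = mpoly_comp d e P \<oplus>\<^bsub>?T\<^esub> mpoly_comp d e Q" for e
    by (auto simp: mpoly_comp_def mpoly_ring_simps indexed_padd_def shift_comp_add)
  fix e e' assume e: "mpoly_comp d e P = P" "mpoly_comp d e' Q = Q"
  show "mpoly_comp d (e + e') (P \<otimes>\<^bsub>?T\<^esub> Q) = P \<otimes>\<^bsub>?T\<^esub> Q"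
  proof
    fix n
    have "mpoly_comp d (e + e') (P \<otimes>\<^bsub>?T\<^esub> Q) n
        = (\<Oplus>a\<in>{a. a \<subseteq># n}. shift_comp (\<Sum>j\<in>#n. d j) (e + e') (P a \<otimes> Q (n - a)))"
      unfolding mpoly_comp_def mpoly_mult_coeff by (rule shift_comp_finsum) auto
    also have "\<dots> = (\<Oplus>a\<in>{a. a \<subseteq># n}. P a \<otimes> Q (n - a))"
    proof (intro finsum_cong')
      fix a assume "a \<in> {a. a \<subseteq># n}"
      then have "(\<Sum>j\<in>#n. d j) = (\<Sum>j\<in>#a. d j) + (\<Sum>j\<in>#n - a. d j)"
        by (metis image_mset_union mem_Collect_eq subset_mset.add_diff_inverse sum_mset.union)
      moreover have "shift_comp (\<Sum>j\<in>#a. d j) e (P a) = P a"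
        using fun_cong[OF e(1), of a] by (simp add: mpoly_comp_def)
      moreover have "shift_comp (\<Sum>j\<in>#n - a. d j) e' (Q (n - a)) = Q (n - a)"
        using fun_cong[OF e(2), of "n - a"] by (simp add: mpoly_comp_def)
      ultimately show "shift_comp (\<Sum>j\<in>#n. d j) (e + e') (P a \<otimes> Q (n - a)) = P a \<otimes> Q (n - a)"
        by (simp add: shift_comp_mult)
    qed auto
    also have "\<dots> = (P \<otimes>\<^bsub>?T\<^esub> Q) n"
      by (simp add: mpoly_mult_coeff)
    finally show "mpoly_comp d (e + e') (P \<otimes>\<^bsub>?T\<^esub> Q) n = (P \<otimes>\<^bsub>?T\<^esub> Q) n" .
  qed
qed

lemma mpoly_comp_const: "mpoly_comp d e (indexed_const c) = indexed_const (\<pi> e c)"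
  by (auto simp: mpoly_comp_def indexed_const_def)

lemma mpoly_comp_var: "mpoly_comp d (d i) (indexed_var i) = indexed_var i"
proof -
  have "shift_comp (d i) (d i) \<one> = \<one>"
    using shift_comp_add_degree[of "d i" 0 \<one>] by (simp add: comp_0_one)
  then show ?thesis
    by (auto simp: mpoly_comp_def indexed_var_def indexed_pmult_def indexed_const_def fun_eq_iff
      dest!: multi_member_split)
qed

lemma mpoly_shift_comp_const:
  "graded_cring.shift_comp (mpoly_ring R V) (mpoly_comp d) w e (indexed_const c)
    = indexed_const (shift_comp w e c)"
proof -
  interpret T: graded_cring "mpoly_ring R V" "mpoly_comp d" by (rule mpoly_graded_cring)
  show ?thesis
    by (rule shift_comp_cases[of e w])
      (auto simp: mpoly_comp_const T.shift_comp_no_degree mpoly_ring_simps)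
qed

lemma mpoly_comp_mult_var:
  assumes P: "P \<in> carrier (mpoly_ring R V)" and i: "i \<in> V"
  shows "mpoly_comp d e (P \<otimes>\<^bsub>mpoly_ring R V\<^esub> indexed_var i)
    = graded_cring.shift_comp (mpoly_ring R V) (mpoly_comp d) (d i) e P
      \<otimes>\<^bsub>mpoly_ring R V\<^esub> indexed_var i"
proof -
  interpret T: graded_cring "mpoly_ring R V" "mpoly_comp d" by (rule mpoly_graded_cring)
  show ?thesis
    using assms by (intro T.comp_mult_homogeneous mpoly_comp_var indexed_var_closed)
qed

section \<open>Homogeneity of \<open>L\<close> and \<open>J\<close> for homogeneous
  generators\<close>

lemma mpoly_comp_linear_form:
  assumes a: "a \<in> {..<m} \<rightarrow> carrier R"
  shows "mpoly_comp d e (linear_form m a) = linear_form m (\<lambda>i. shift_comp (d i) e (a i))"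
proof -
  let ?T = "mpoly_ring R {..<m}"
  interpret T: graded_cring ?T "mpoly_comp d" by (rule mpoly_graded_cring)
  have cl: "indexed_const (a i) \<in> carrier ?T" "indexed_var i \<in> carrier ?T" if "i < m" for i
    using that a by (auto intro!: indexed_const_closed indexed_var_closed)
  have "mpoly_comp d e (linear_form m a)
      = (\<Oplus>\<^bsub>?T\<^esub>i\<in>{..<m}. mpoly_comp d e (indexed_const (a i) \<otimes>\<^bsub>?T\<^esub> indexed_var i))"
    unfolding linear_form_def using cl by (intro T.comp_finsum) auto
  also have "\<dots> = linear_form m (\<lambda>i. shift_comp (d i) e (a i))"
    unfolding linear_form_def
  proof (intro T.finsum_cong')
    fix i assume i: "i \<in> {..<m}"
    then show "mpoly_comp d e (indexed_const (a i) \<otimes>\<^bsub>?T\<^esub> indexed_var i)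
        = indexed_const (shift_comp (d i) e (a i)) \<otimes>\<^bsub>?T\<^esub> indexed_var i"
      using cl by (subst mpoly_comp_mult_var) (auto simp: mpoly_shift_comp_const)
  qed (use a cl in \<open>auto intro!: T.m_closed indexed_const_closed shift_comp_closed\<close>)
  finally show ?thesis .
qed

text \<open>The degree \<open>e\<close> component of a relation among the \<open>f i\<close> is
  again a relation, and its coefficients are those of the degree \<open>e\<close> component of the
  linear form. So the generating set of \<open>L\<close> is already closed under components.\<close>

lemma linear_ideal_comp_closed:
  assumes f: "\<And>i. i < m \<Longrightarrow> f i \<in> carrier R" "\<And>i. i < m \<Longrightarrow> \<pi> (d i) (f i) = f i"
    and P: "P \<in> linear_ideal R m f"
  shows "mpoly_comp d e P \<in> linear_ideal R m f"
proof -
  let ?T = "mpoly_ring R {..<m}"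
  interpret T: graded_cring ?T "mpoly_comp d" by (rule mpoly_graded_cring)
  show ?thesis
    using P unfolding linear_ideal_def
  proof (rule T.genideal_comp_closed[rotated 2])
    show sub: "linear_relations R m f \<subseteq> carrier ?T"
      by (auto simp: linear_relations_eq intro: linear_form_closed)
    fix P e assume "P \<in> linear_relations R m f"
    then obtain a where P: "P = linear_form m a" and a: "a \<in> {..<m} \<rightarrow> carrier R"
      and rel: "(\<Oplus>i\<in>{..<m}. a i \<otimes> f i) = \<zero>"
      by (auto simp: linear_relations_eq)
    have ai: "a i \<in> carrier R" if "i < m" for i
      using a that by auto
    have "(\<Oplus>i\<in>{..<m}. shift_comp (d i) e (a i) \<otimes> f i) = (\<Oplus>i\<in>{..<m}. \<pi> e (a i \<otimes> f i))"
      using ai f by (intro finsum_cong') (auto intro!: comp_mult_homogeneous[symmetric])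
    also have "\<dots> = \<pi> e (\<Oplus>i\<in>{..<m}. a i \<otimes> f i)"
      using ai f by (intro comp_finsum[symmetric]) auto
    also have "\<dots> = \<zero>"
      by (simp add: rel)
    finally have "mpoly_comp d e P \<in> linear_relations R m f"
      using ai by (auto simp: P mpoly_comp_linear_form[OF a] linear_relations_eq)
    then show "mpoly_comp d e P \<in> genideal ?T (linear_relations R m f)"
      using T.genideal_self[OF sub] by auto
  qed
qed

text \<open>With \<open>t\<close> in degree zero, \<open>R[t]\<close> is graded coefficient by
  coefficient, and the Rees map respects degrees because \<open>f i t\<close> has the degree
  \<open>d i\<close> of its variable. Reading this off at each power of \<open>t\<close> avoids
  constructing a grading of \<open>UP R\<close>.\<close>

lemma rees_hom_comp:
  assumes f: "\<And>i. i < m \<Longrightarrow> f i \<in> carrier R" "\<And>i. i < m \<Longrightarrow> \<pi> (d i) (f i) = f i"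
    and P: "P \<in> carrier (mpoly_ring R {..<m})"
  shows "up_ring.coeff (UP R) (rees_hom R f (mpoly_comp d e P)) n
    = \<pi> e (up_ring.coeff (UP R) (rees_hom R f P) n)"
  using P
proof (induction arbitrary: e n rule: mpoly_induct)
  let ?T = "mpoly_ring R {..<m}"
  interpret T: graded_cring ?T "mpoly_comp d" by (rule mpoly_graded_cring)
  interpret U: UP_cring R "UP R"
    by (unfold_locales) simp
  have f': "f \<in> {..<m} \<rightarrow> carrier R" using f by auto
  interpret H: ring_hom_cring ?T "UP R" "rees_hom R f" by (rule rees_hom_hom[OF f'])
  {
    case (const c)
    then show ?case
      by (simp add: mpoly_comp_const rees_hom_hom(2)[OF f'])
  next
    case (add P Q)
    then show ?case
      by (simp add: T.comp_add comp_add)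
  next
    case (mult P i)
    let ?c = "\<lambda>P. up_ring.coeff (UP R) (rees_hom R f P)"
    have i: "i < m" using mult by simp
    \<comment> \<open>Multiplication by \<open>f i t\<close> raises the power of \<open>t\<close> by
      one, so nothing arrives at power zero.\<close>
    have coeff: "?c (Q \<otimes>\<^bsub>?T\<^esub> indexed_var i) n = (if n = 0 then \<zero> else ?c Q (n - 1) \<otimes> f i)"
      if "Q \<in> carrier ?T" for Q n
    proof (cases n)
      case (Suc k)
      have "?c (Q \<otimes>\<^bsub>?T\<^esub> indexed_var i) (Suc k)
          = up_ring.coeff (UP R) (up_ring.monom (UP R) (f i) 1 \<otimes>\<^bsub>UP R\<^esub> rees_hom R f Q) (k + 1)"
        using that i by (simp add: indexed_var_closed rees_hom_hom(3)[OF f'] U.m_comm f)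
      also have "\<dots> = f i \<otimes> ?c Q k"
        using that i f by (intro U.coeff_monom_mult) auto
      finally show ?thesis
        using that i f by (simp add: Suc m_comm)
    next
      case 0
      then show ?thesis
        using that i by (simp add: indexed_var_closed rees_hom_hom(3)[OF f'] f)
    qed
    \<comment> \<open>The induction hypothesis is available in every degree, in particular in the
      degree \<open>j\<close> with \<open>e = j + w\<close> if there is one; otherwise both sides
      are zero.\<close>
    have shift: "?c (T.shift_comp w e P) n = shift_comp w e (?c P n)" for w n
    proof (rule shift_comp_cases[of e w])
      fix j assume "e = j + w" "\<And>x. shift_comp w e x = \<pi> j x"
      then show ?thesis using mult.IH by simp
    next
      assume "\<nexists>i. e = i + w" "\<And>x. shift_comp w e x = \<zero>"
      then show ?thesis by (simp add: T.shift_comp_no_degree)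
    qed
    show ?case
      using mult i f
      by (simp add: mpoly_comp_mult_var coeff T.shift_comp_closed shift comp_mult_homogeneous[where d = "d i"])
  }
qed

lemma rees_ideal_comp_closed:
  assumes f: "\<And>i. i < m \<Longrightarrow> f i \<in> carrier R" "\<And>i. i < m \<Longrightarrow> \<pi> (d i) (f i) = f i"
    and P: "P \<in> rees_ideal R m f"
  shows "mpoly_comp d e P \<in> rees_ideal R m f"
proof -
  interpret U: UP_cring R "UP R"
    by (unfold_locales) simp
  have f': "f \<in> {..<m} \<rightarrow> carrier R" using f by auto
  interpret H: ring_hom_cring "mpoly_ring R {..<m}" "UP R" "rees_hom R f" by (rule rees_hom_hom[OF f'])
  have P': "P \<in> carrier (mpoly_ring R {..<m})" "rees_hom R f P = \<zero>\<^bsub>UP R\<^esub>"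
    using P by (auto simp: rees_ideal_eq)
  then have "rees_hom R f (mpoly_comp d e P) = \<zero>\<^bsub>UP R\<^esub>"
    by (intro U.up_eqI) (auto simp: rees_hom_comp[where d = d, OF f P'(1)] mpoly_comp_closed)
  then show ?thesis
    using P' by (simp add: rees_ideal_eq mpoly_comp_closed)
qed

lemma conductor_comp_closed_homogeneous:
  assumes f: "\<And>i. i < m \<Longrightarrow> f i \<in> carrier R" "\<And>i. i < m \<Longrightarrow> \<pi> (d i) (f i) = f i"
    and r: "r \<in> conductor R m f"
  shows "\<pi> k r \<in> conductor R m f"
proof -
  let ?T = "mpoly_ring R {..<m}"
  interpret T: graded_cring ?T "mpoly_comp d" by (rule mpoly_graded_cring)
  interpret C: ring_hom_cring R ?T indexed_const by (rule indexed_const_hom)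
  interpret L: ideal "linear_ideal R m f" ?T by (rule linear_ideal_ideal)
  have rR: "r \<in> carrier R" using r by (simp add: conductor_def)
  have "indexed_const (\<pi> k r) \<otimes>\<^bsub>?T\<^esub> P \<in> linear_ideal R m f" if P: "P \<in> rees_ideal R m f" for P
  proof -
    have PT: "P \<in> carrier ?T"
      using P by (simp add: rees_ideal_eq)
    let ?E = "{e. mpoly_comp d e P \<noteq> \<zero>\<^bsub>?T\<^esub>}"
    \<comment> \<open>\<open>P\<close> itself may be inhomogeneous. Its components again lie in the
      Rees ideal, so each of them is treated separately and the results are summed in
      \<open>L\<close>.\<close>
    have "indexed_const (\<pi> k r) \<otimes>\<^bsub>?T\<^esub> P
        = indexed_const (\<pi> k r) \<otimes>\<^bsub>?T\<^esub> (\<Oplus>\<^bsub>?T\<^esub>e\<in>?E. mpoly_comp d e P)"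
      by (simp add: T.comp_sum[OF PT])
    also have "\<dots> = (\<Oplus>\<^bsub>?T\<^esub>e\<in>?E. indexed_const (\<pi> k r) \<otimes>\<^bsub>?T\<^esub> mpoly_comp d e P)"
      using T.comp_finite[OF PT] PT rR by (intro T.finsum_rdistr) auto
    also have "\<dots> \<in> linear_ideal R m f"
    proof (rule L.finsum_in_ideal)
      fix e
      have "indexed_const r \<otimes>\<^bsub>?T\<^esub> mpoly_comp d e P \<in> linear_ideal R m f"
        using r rees_ideal_comp_closed[where d = d, OF f P] by (simp add: conductor_def)
      then have "mpoly_comp d (k + e) (indexed_const r \<otimes>\<^bsub>?T\<^esub> mpoly_comp d e P) \<in> linear_ideal R m f"
        by (intro linear_ideal_comp_closed[where d = d] f)
      moreover have "mpoly_comp d (k + e) (indexed_const r \<otimes>\<^bsub>?T\<^esub> mpoly_comp d e P)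
          = T.shift_comp e (k + e) (indexed_const r) \<otimes>\<^bsub>?T\<^esub> mpoly_comp d e P"
        using PT rR by (intro T.comp_mult_homogeneous) (auto simp: T.comp_comp)
      ultimately show "indexed_const (\<pi> k r) \<otimes>\<^bsub>?T\<^esub> mpoly_comp d e P \<in> linear_ideal R m f"
        by (simp add: mpoly_comp_const)
    qed
    finally show ?thesis .
  qed
  with rR show ?thesis
    by (simp add: conductor_def)
qed

text \<open>The nonzero components of all \<open>f j\<close> are finite in number. They lie in the
  ideal, which is closed under components, and each \<open>f j\<close> is the sum of its
  own.\<close>

lemma homogeneous_generators:
  assumes gen: "generated_by R I m f" and comp: "\<And>x i. x \<in> I \<Longrightarrow> \<pi> i x \<in> I"
  obtains l g d where "\<And>i. i < l \<Longrightarrow> g i \<in> carrier R" "\<And>i. i < l \<Longrightarrow> \<pi> (d i) (g i) = g i"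
    "genideal R (f ` {..<m}) = genideal R (g ` {..<l::nat})"
proof -
  have f: "\<And>j. j < m \<Longrightarrow> f j \<in> carrier R" and I: "I = genideal R (f ` {..<m})"
    using gen by (auto simp: generated_by_def)
  have fS: "f ` {..<m} \<subseteq> carrier R"
    using f by auto
  define G where "G = (\<Union>j\<in>{..<m}. (\<lambda>i. \<pi> i (f j)) ` {i. \<pi> i (f j) \<noteq> \<zero>})"
  have "finite G"
    unfolding G_def using f comp_finite by auto
  then obtain g where "bij_betw g {0..<card G} G"
    using ex_bij_betw_nat_finite by blast
  then have gG: "g ` {..<card G} = G"
    by (auto simp: bij_betw_def atLeast0LessThan)
  have GR: "G \<subseteq> carrier R"
    unfolding G_def using f by auto
  have "\<exists>d. \<pi> d x = x" if "x \<in> G" for x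
  proof -
    from that obtain i j where "j < m" "x = \<pi> i (f j)"
      by (auto simp: G_def)
    then have "\<pi> i x = x"
      using f by (simp add: comp_comp)
    then show ?thesis ..
  qed
  \<comment> \<open>The enumeration of \<open>G\<close> forgets which component an element came
    from, so its degree is recovered by choice.\<close>
  then have g_homogeneous: "\<pi> (SOME d. \<pi> d (g i) = g i) (g i) = g i" if "i < card G" for i
    using gG that by (intro someI_ex[of "\<lambda>d. \<pi> d (g i) = g i"]) auto
  have g_closed: "g i \<in> carrier R" if "i < card G" for i
    using gG GR that by auto
  have ideal_eq: "genideal R (f ` {..<m}) = genideal R (g ` {..<card G})"
  proof
    have "f j \<in> genideal R G" if "j < m" for j
    proof -
      interpret G: ideal "genideal R G" R by (rule genideal_ideal[OF GR])
      have "(\<Oplus>i\<in>{i. \<pi> i (f j) \<noteq> \<zero>}. \<pi> i (f j)) \<in> genideal R G"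
        using genideal_self[OF GR] that by (intro G.finsum_in_ideal) (auto simp: G_def)
      then show ?thesis
        using f that by (simp add: comp_sum)
    qed
    then show "genideal R (f ` {..<m}) \<subseteq> genideal R (g ` {..<card G})"
      using GR by (intro genideal_minimal genideal_ideal) (auto simp: gG)
    have "G \<subseteq> genideal R (f ` {..<m})"
      using genideal_self[OF fS] comp by (auto simp: G_def I)
    then show "genideal R (g ` {..<card G}) \<subseteq> genideal R (f ` {..<m})"
      using fS by (intro genideal_minimal genideal_ideal) (auto simp: gG)
  qed
  show thesis
    by (rule that[of "card G" g "\<lambda>i. SOME d. \<pi> d (g i) = g i"])
      (simp_all add: g_homogeneous g_closed ideal_eq)
qed

text \<open>The common form of both cases of the result: of the ideal, only a finite system of
  generators and closure under components enter.\<close>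

theorem conductor_comp_closed:
  assumes gen: "generated_by R I m f" and comp: "\<And>x i. x \<in> I \<Longrightarrow> \<pi> i x \<in> I"
    and r: "r \<in> conductor R m f"
  shows "\<pi> k r \<in> conductor R m f"
proof -
  obtain l g d where g: "\<And>i. i < l \<Longrightarrow> g i \<in> carrier R" "\<And>i. i < l \<Longrightarrow> \<pi> (d i) (g i) = g i"
    "genideal R (f ` {..<m}) = genideal R (g ` {..<l::nat})"
    using homogeneous_generators[OF gen comp] by blast
  have "conductor R m f = conductor R l g"
    using gen g by (intro conductor_cong_generators) (auto simp: generated_by_def)
  then show ?thesis
    using conductor_comp_closed_homogeneous[where d = d, OF g(1,2)] r by simp
qed

end

text \<open>Needed before \<open>genideal_of_components\<close> can be applied to the
  conductor.\<close>

lemma (in cring) conductor_ideal: "ideal (conductor R m f) R"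
proof (rule ideal_if_closed)
  let ?T = "mpoly_ring R {..<m}"
  interpret T: cring ?T by (rule cring_mpoly_ring)
  interpret C: ring_hom_cring R ?T indexed_const by (rule indexed_const_hom)
  interpret L: ideal "linear_ideal R m f" ?T by (rule linear_ideal_ideal)
  have J: "P \<in> rees_ideal R m f \<Longrightarrow> P \<in> carrier ?T" for P
    by (simp add: rees_ideal_eq)
  show "conductor R m f \<subseteq> carrier R" "\<zero> \<in> conductor R m f"
    by (auto simp: conductor_def J L.zero_closed)
  show "x \<oplus> y \<in> conductor R m f" if "x \<in> conductor R m f" "y \<in> conductor R m f" for x y
    using that by (auto simp: conductor_def J T.l_distr L.a_closed)
  show "r \<otimes> x \<in> conductor R m f" if "r \<in> carrier R" "x \<in> conductor R m f" for r x
    using that by (auto simp: conductor_def J T.m_assoc L.I_l_closed)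
qed

section \<open>Graded and monomial ideals\<close>

text \<open>The projections are the entries of the unique decomposition. Their laws follow from
  uniqueness, each time by exhibiting a decomposition of the element in question.\<close>

lemma graded_ring_projections:
  assumes "graded_ring R A"
  obtains \<pi> where "graded_cring R \<pi>" "\<And>i x. x \<in> A i \<longleftrightarrow> x \<in> carrier R \<and> \<pi> i x = x"
proof -
  interpret cring R using assms by (simp add: graded_ring_def)
  have A: "additive_subgroup (A i) R" for i
    using assms by (simp add: graded_ring_def)
  note A_closed = additive_subgroup.a_closed[OF A] and A_zero = additive_subgroup.zero_closed[OF A]
    and A_carrier = additive_subgroup.a_Hcarr[OF A]
  have A_mult: "x \<otimes>\<^bsub>R\<^esub> y \<in> A (i + j)" if "x \<in> A i" "y \<in> A j" for x y i j
    using assms that by (simp add: graded_ring_def)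
  define D where "D x c \<longleftrightarrow> (\<forall>i. c i \<in> A i) \<and> finite {i. c i \<noteq> \<zero>\<^bsub>R\<^esub>} \<and>
       x = (\<Oplus>\<^bsub>R\<^esub>i\<in>{i. c i \<noteq> \<zero>\<^bsub>R\<^esub>}. c i)" for x c
  have ex1: "\<exists>!c. D x c" if "x \<in> carrier R" for x
    using assms that by (simp add: graded_ring_def D_def)
  define \<pi> where "\<pi> i x = (THE c. D x c) i" for i x
  have D_pi: "D x (\<lambda>i. \<pi> i x)" if "x \<in> carrier R" for x
    unfolding \<pi>_def using theI'[OF ex1[OF that]] by simp
  have pi_A: "\<pi> i x \<in> A i" if "x \<in> carrier R" for x i
    using D_pi[OF that] by (simp add: D_def)
  have pi_finite: "finite {i. \<pi> i x \<noteq> \<zero>\<^bsub>R\<^esub>}" if "x \<in> carrier R" for x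
    using D_pi[OF that] by (simp add: D_def)
  have pi_sum: "(\<Oplus>\<^bsub>R\<^esub>i\<in>{i. \<pi> i x \<noteq> \<zero>\<^bsub>R\<^esub>}. \<pi> i x) = x" if "x \<in> carrier R" for x
    using D_pi[OF that] by (simp add: D_def)
  have sum_superset: "(\<Oplus>\<^bsub>R\<^esub>i\<in>F. c i) = (\<Oplus>\<^bsub>R\<^esub>i\<in>{i. c i \<noteq> \<zero>\<^bsub>R\<^esub>}. c i)"
    if "\<And>i. c i \<in> A i" "finite F" "{i. c i \<noteq> \<zero>\<^bsub>R\<^esub>} \<subseteq> F" for c F
    using that A_carrier by (intro add.finprod_mono_neutral_cong_right) auto
  \<comment> \<open>The definition of \<open>graded_ring\<close> sums over the exact support.
    Allowing any finite superset makes uniqueness usable for sums, where cancellation may shrink the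
    support, and for a homogeneous \<open>h\<close> that may be zero.\<close>
  have pi_eqI: "\<pi> i x = c i"
    if c: "\<And>i. c i \<in> A i" and F: "finite F" "{i. c i \<noteq> \<zero>\<^bsub>R\<^esub>} \<subseteq> F" and x: "x = (\<Oplus>\<^bsub>R\<^esub>i\<in>F. c i)"
    for c F x i
  proof -
    have "x \<in> carrier R"
      unfolding x using c A_carrier by (intro finsum_closed) auto
    moreover have "D x c"
      using c F finite_subset[OF F(2,1)] sum_superset[OF c F] by (simp add: D_def x)
    ultimately show ?thesis
      using ex1[of x] by (metis \<pi>_def the1_equality)
  qed
  have pi_homogeneous: "\<pi> i h = (if i = j then h else \<zero>\<^bsub>R\<^esub>)" if "h \<in> A j" for h i j
    using that A_zero A_carrier by (intro pi_eqI[of "\<lambda>i. if i = j then h else \<zero>\<^bsub>R\<^esub>" "{j}"]) auto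
  have mem_A: "x \<in> A i \<longleftrightarrow> x \<in> carrier R \<and> \<pi> i x = x" for x i
    using pi_homogeneous pi_A[of x i] A_carrier by auto
  have "graded_cring R \<pi>"
  proof (intro graded_cring.intro graded_cring_axioms.intro)
    show "cring R" by (rule is_cring)
    fix x assume x: "x \<in> carrier R"
    show "\<pi> i x \<in> carrier R" for i
      using pi_A[OF x] A_carrier by blast
    show "finite {i. \<pi> i x \<noteq> \<zero>\<^bsub>R\<^esub>}" by (rule pi_finite[OF x])
    show "(\<Oplus>\<^bsub>R\<^esub>i\<in>{i. \<pi> i x \<noteq> \<zero>\<^bsub>R\<^esub>}. \<pi> i x) = x" by (rule pi_sum[OF x])
    show "\<pi> i (\<pi> j x) = (if i = j then \<pi> i x else \<zero>\<^bsub>R\<^esub>)" for i j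
      using pi_homogeneous[OF pi_A[OF x]] by simp
    fix y assume y: "y \<in> carrier R"
    let ?F = "{i. \<pi> i x \<noteq> \<zero>\<^bsub>R\<^esub>} \<union> {i. \<pi> i y \<noteq> \<zero>\<^bsub>R\<^esub>}"
    have fin: "finite ?F"
      using x y pi_finite by simp
    have "x \<oplus>\<^bsub>R\<^esub> y = (\<Oplus>\<^bsub>R\<^esub>i\<in>?F. \<pi> i x) \<oplus>\<^bsub>R\<^esub> (\<Oplus>\<^bsub>R\<^esub>i\<in>?F. \<pi> i y)"
      using sum_superset[of "\<lambda>i. \<pi> i x" ?F] sum_superset[of "\<lambda>i. \<pi> i y" ?F] fin pi_A x y pi_sum
      by auto
    also have "\<dots> = (\<Oplus>\<^bsub>R\<^esub>i\<in>?F. \<pi> i x \<oplus>\<^bsub>R\<^esub> \<pi> i y)"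
      using pi_A x y A_carrier by (intro finsum_addf[symmetric]) blast+
    finally show "\<pi> i (x \<oplus>\<^bsub>R\<^esub> y) = \<pi> i x \<oplus>\<^bsub>R\<^esub> \<pi> i y" for i
      using fin pi_A[OF x] pi_A[OF y] A_closed
      by (intro pi_eqI[of "\<lambda>i. \<pi> i x \<oplus>\<^bsub>R\<^esub> \<pi> i y" ?F]) auto
    show "\<pi> (i + j) (x \<otimes>\<^bsub>R\<^esub> y) = x \<otimes>\<^bsub>R\<^esub> y" if "\<pi> i x = x" "\<pi> j y = y" for i j
      using A_mult[of x i y j] pi_homogeneous[of "x \<otimes>\<^bsub>R\<^esub> y" "i + j" "i + j"] pi_A[OF x, of i] pi_A[OF y, of j] that
      by simp
  qed
  then show thesis
    using mem_A by (rule that)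
qed

lemma graded_ideal_conductor:
  assumes "graded_ring R A" "graded_ideal R A I" "generated_by R I m f"
  shows "graded_ideal R A (conductor R m f)"
proof (rule graded_ring_projections[OF assms(1)])
  fix \<pi>
  assume "graded_cring R \<pi>" and A: "\<And>i x. x \<in> A i \<longleftrightarrow> x \<in> carrier R \<and> \<pi> i x = x"
  then interpret graded_cring R \<pi> by simp
  obtain S where S: "S \<subseteq> (\<Union>i. A i)" "I = genideal R S"
    using assms(2) by (auto simp: graded_ideal_def)
  have hom: "\<exists>j. \<pi> j s = s" and sR: "s \<in> carrier R" if "s \<in> S" for s
    using S(1) that by (auto simp: A dest!: subsetD)
  have SR: "S \<subseteq> carrier R"
    using sR by (rule subsetI)
  interpret I: ideal "genideal R S" R
    by (rule genideal_ideal[OF SR])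
  \<comment> \<open>A generator fixed by the projection of one degree has zero component in every
    other degree, by \<open>comp_comp\<close>.\<close>
  have "\<pi> i s \<in> genideal R S" if s: "s \<in> S" for i s
  proof -
    obtain j where "\<pi> j s = s"
      using hom[OF s] by (rule exE)
    then have "\<pi> i s = (if i = j then s else \<zero>\<^bsub>R\<^esub>)"
      using comp_comp[OF sR[OF s], of i j] by (cases "i = j") simp_all
    then show ?thesis
      using genideal_self[OF SR] s I.zero_closed by auto
  qed
  then have "\<pi> i x \<in> I" if "x \<in> I" for i x
    using genideal_comp_closed[OF SR] that S(2) by simp
  then have "\<pi> i x \<in> conductor R m f" if "x \<in> conductor R m f" for i x
    using conductor_comp_closed[OF assms(3)] that by simp
  then have "conductor R m f = genideal R {\<pi> i x | i x. x \<in> conductor R m f}"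
    by (intro genideal_of_components[symmetric] conductor_ideal)
  moreover have "{\<pi> i x | i x. x \<in> conductor R m f} \<subseteq> (\<Union>i. A i)"
    using A by (auto simp: conductor_def comp_comp)
  ultimately show ?thesis
    unfolding graded_ideal_def by blast
qed

section \<open>The grading of \<open>K[V]\<close> by monomials\<close>

definition (in ring) monomial_comp :: "'v multiset \<Rightarrow> ('v multiset \<Rightarrow> 'a) \<Rightarrow> 'v multiset \<Rightarrow> 'a"
  where "monomial_comp n P = (\<lambda>k. if k = n then P n else \<zero>)"

text \<open>Multisets under addition are a cancellative monoid, and the homogeneous elements of
  degree \<open>n\<close> are the terms at \<open>n\<close>. In a product of a term at
  \<open>i\<close> and a term at \<open>j\<close>, every factorisation of a monomial other than
  \<open>i + j\<close> meets a zero coefficient.\<close>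

lemma (in cring) mpoly_graded_by_monomials: "graded_cring (mpoly_ring R V) monomial_comp"
proof (intro graded_cring.intro graded_cring_axioms.intro)
  let ?T = "mpoly_ring R V"
  show "cring ?T" by (rule cring_mpoly_ring)
  fix P assume P: "P \<in> carrier ?T"
  note [simp] = mpoly_coeff_closed[OF P]
  show cl: "monomial_comp n P \<in> carrier ?T" for n
    using P by (auto simp: monomial_comp_def mpoly_ring_simps mem_indexed_pset_iff)
  show "monomial_comp i (monomial_comp j P) = (if i = j then monomial_comp i P else \<zero>\<^bsub>?T\<^esub>)" for i j
    by (auto simp: monomial_comp_def mpoly_ring_simps indexed_const_def)
  have supp: "{n. monomial_comp n P \<noteq> \<zero>\<^bsub>?T\<^esub>} = {n. P n \<noteq> \<zero>}"
    by (auto simp: monomial_comp_def mpoly_ring_simps indexed_const_def fun_eq_iff)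
  show fin: "finite {n. monomial_comp n P \<noteq> \<zero>\<^bsub>?T\<^esub>}"
    using P unfolding supp by (simp add: mpoly_ring_simps mem_indexed_pset_iff)
  show "(\<Oplus>\<^bsub>?T\<^esub>n\<in>{n. monomial_comp n P \<noteq> \<zero>\<^bsub>?T\<^esub>}. monomial_comp n P) = P"
  proof
    fix k
    have "(\<Oplus>\<^bsub>?T\<^esub>n\<in>{n. P n \<noteq> \<zero>}. monomial_comp n P) k = (\<Oplus>n\<in>{n. P n \<noteq> \<zero>}. if k = n then P n else \<zero>)"
      by (subst mpoly_finsum_coeff[OF cl]) (simp add: monomial_comp_def)
    also have "\<dots> = P k"
    proof (cases "P k = \<zero>")
      case True
      then have "(\<Oplus>n\<in>{n. P n \<noteq> \<zero>}. if k = n then P n else \<zero>) = (\<Oplus>n\<in>{n. P n \<noteq> \<zero>}. \<zero>)"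
        by (intro finsum_cong') auto
      with True show ?thesis by simp
    next
      case False
      then show ?thesis
        using fin unfolding supp by (intro finsum_singleton) auto
    qed
    finally show "(\<Oplus>\<^bsub>?T\<^esub>n\<in>{n. monomial_comp n P \<noteq> \<zero>\<^bsub>?T\<^esub>}. monomial_comp n P) k = P k"
      by (simp add: supp)
  qed
  fix Q assume Q: "Q \<in> carrier ?T"
  note [simp] = mpoly_coeff_closed[OF Q]
  show "monomial_comp n (P \<oplus>\<^bsub>?T\<^esub> Q) = monomial_comp n P \<oplus>\<^bsub>?T\<^esub> monomial_comp n Q" for n
    by (auto simp: monomial_comp_def mpoly_ring_simps indexed_padd_def)
  fix i j assume ij: "monomial_comp i P = P" "monomial_comp j Q = Q"
  have "(P \<otimes>\<^bsub>?T\<^esub> Q) n = \<zero>" if "n \<noteq> i + j" for n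
  proof -
    have "P a \<otimes> Q (n - a) = \<zero>" if a: "a \<subseteq># n" for a
    proof -
      have "a \<noteq> i \<or> n - a \<noteq> j"
        using \<open>n \<noteq> i + j\<close> a by (metis subset_mset.add_diff_inverse)
      then have "P a = \<zero> \<or> Q (n - a) = \<zero>"
        using fun_cong[OF ij(1), of a] fun_cong[OF ij(2), of "n - a"]
        by (auto simp: monomial_comp_def split: if_splits)
      then show ?thesis by auto
    qed
    then have "(P \<otimes>\<^bsub>?T\<^esub> Q) n = (\<Oplus>a\<in>{a. a \<subseteq># n}. \<zero>)"
      unfolding mpoly_mult_coeff by (intro finsum_cong') auto
    then show ?thesis by simp
  qed
  then show "monomial_comp (i + j) (P \<otimes>\<^bsub>?T\<^esub> Q) = P \<otimes>\<^bsub>?T\<^esub> Q"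
    by (auto simp: monomial_comp_def)
qed

lemma (in ring) monomials_closed: "monomials R V \<subseteq> carrier (mpoly_ring R V)"
  by (auto simp: monomials_def mpoly_ring_def mem_indexed_pset_iff)

text \<open>The grading argument only shows that the conductor is generated by terms. Since nonzero
  coefficients in a field are units, the underlying monomials lie in the conductor as well and
  generate the same ideal.\<close>

lemma monomial_ideal_conductor:
  assumes "field K" "monomial_ideal K V I" "generated_by (mpoly_ring K V) I m f"
  shows "monomial_ideal K V (conductor (mpoly_ring K V) m f)"
proof -
  let ?R = "mpoly_ring K V" and ?C = "conductor (mpoly_ring K V) m f"
  interpret K: field K by fact
  interpret graded_cring ?R K.monomial_comp by (rule K.mpoly_graded_by_monomials)
  obtain S where S: "S \<subseteq> monomials K V" "I = genideal ?R S"
    using assms(2) by (auto simp: monomial_ideal_def)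
  have SR: "S \<subseteq> carrier ?R"
    using S K.monomials_closed by blast
  interpret I: ideal "genideal ?R S" ?R
    by (rule genideal_ideal[OF SR])
  have "K.monomial_comp n s \<in> genideal ?R S" if s: "s \<in> S" for n s
  proof -
    have "K.monomial_comp n s = s \<or> K.monomial_comp n s = \<zero>\<^bsub>?R\<^esub>"
    proof -
      obtain a where "s = (\<lambda>k. if k = a then \<one>\<^bsub>K\<^esub> else \<zero>\<^bsub>K\<^esub>)"
        using s S(1) unfolding monomials_def by blast
      then show ?thesis
        by (auto simp: K.monomial_comp_def K.mpoly_ring_simps K.indexed_const_def fun_eq_iff)
    qed
    then show ?thesis
      using genideal_self[OF SR] s I.zero_closed by auto
  qed
  then have "K.monomial_comp n x \<in> I" if "x \<in> I" for n x
    using genideal_comp_closed[OF SR] that S by blast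
  then have comp: "K.monomial_comp n x \<in> ?C" if "x \<in> ?C" for n x
    using conductor_comp_closed[OF assms(3)] that by blast
  interpret C: ideal ?C ?R by (rule conductor_ideal)
  \<comment> \<open>The candidate generating set consists of all monomials in the conductor; what
    remains is that every component of an element of the conductor lies in the ideal that they
    generate.\<close>
  let ?M = "?C \<inter> monomials K V"
  have M: "?M \<subseteq> carrier ?R"
    using K.monomials_closed by blast
  interpret M: ideal "genideal ?R ?M" ?R
    by (rule genideal_ideal[OF M])
  have "K.monomial_comp n x \<in> genideal ?R ?M" if x: "x \<in> ?C" for n x
  proof (cases "x n = \<zero>\<^bsub>K\<^esub>")
    case True
    then have "K.monomial_comp n x = \<zero>\<^bsub>?R\<^esub>"
      by (auto simp: K.monomial_comp_def K.mpoly_ring_simps K.indexed_const_def)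
    then show ?thesis
      by (simp add: M.zero_closed)
  next
    case False
    let ?X = "\<lambda>k. if k = n then \<one>\<^bsub>K\<^esub> else \<zero>\<^bsub>K\<^esub>"
    have xn: "x n \<in> Units K" "x n \<in> carrier K" "set_mset n \<subseteq> V"
      using C.Icarr[OF x] False
      by (auto simp: K.field_Units K.mpoly_ring_simps K.mem_indexed_pset_iff)
    have X: "?X \<in> monomials K V"
      using xn by (auto simp: monomials_def)
    \<comment> \<open>Dividing the component by its coefficient puts the bare monomial into the
      conductor, hence into \<open>?M\<close>; multiplying back recovers the component inside the
      generated ideal.\<close>
    have "K.monomial_comp n x \<otimes>\<^bsub>?R\<^esub> K.indexed_const (inv\<^bsub>K\<^esub> x n) = ?X"
      using xn
      by (subst K.mpoly_mult_const[OF C.Icarr[OF comp[OF x]]]) (auto simp: K.monomial_comp_def fun_eq_iff)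
    then have "?X \<in> ?C"
      using C.I_r_closed[OF comp[OF x, of n] K.indexed_const_closed[of "inv\<^bsub>K\<^esub> x n"]] xn by simp
    then have "?X \<in> genideal ?R ?M"
      using X genideal_self[OF M] by blast
    then have "?X \<otimes>\<^bsub>?R\<^esub> K.indexed_const (x n) \<in> genideal ?R ?M"
      using xn by (intro M.I_r_closed K.indexed_const_closed)
    also have "?X \<otimes>\<^bsub>?R\<^esub> K.indexed_const (x n) = K.monomial_comp n x"
      using xn X K.monomials_closed
      by (subst K.mpoly_mult_const) (auto simp: K.monomial_comp_def fun_eq_iff)
    finally show ?thesis .
  qed
  then have "genideal ?R {K.monomial_comp n x | n x. x \<in> ?C} \<subseteq> genideal ?R ?M"
    by (intro genideal_minimal genideal_ideal[OF M]) auto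
  then have "?C \<subseteq> genideal ?R ?M"
    using genideal_of_components[OF conductor_ideal comp] by simp
  moreover have "genideal ?R ?M \<subseteq> ?C"
    by (intro genideal_minimal conductor_ideal) auto
  ultimately show ?thesis
    unfolding monomial_ideal_def by blast
qed

theorem corollary1p11:
  fixes K :: "('k, 'c) ring_scheme" and V :: "'v set"
    and R :: "('a, 'b) ring_scheme" and A :: "int \<Rightarrow> 'a set"
  shows "(field K \<and> finite V \<longrightarrow>
      (\<forall>I m f. monomial_ideal K V I \<and> generated_by (mpoly_ring K V) I m f \<longrightarrow>
         monomial_ideal K V (conductor (mpoly_ring K V) m f)))
    \<and> (noetherian_ring R \<and> graded_ring R A \<longrightarrow>
      (\<forall>I m f. graded_ideal R A I \<and> generated_by R I m f \<longrightarrow>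
         graded_ideal R A (conductor R m f)))"
  by (auto intro: monomial_ideal_conductor graded_ideal_conductor)

end
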